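(* Let $U$, $V$, $V_1$ be real-valued functions of compact support belonging to $L^\infty(\mathbb{R})$, and let $(V_\lambda)_{\lambda>0}$ be a family of real-valued bounded functions of compact support such that $\|V_\lambda-V-\lambda V_1\|=o(\lambda)$ as $\lambda\to 0$, where $\|\cdot\|$ is the norm of $L_2(\mathbb{R})$. Assume that the operator $-\frac{d^2}{dx^2}+U$ has a zero-energy resonance with normalized half-bound state $u$, and suppose that $$\int_{\mathbb{R}} V u^2\,dx=0.$$ Then the operator $H_\lambda=-\frac{d^2}{dx^2}+U+\lambda V_\lambda$ has the coupling constant threshold $\lambda=0$ (i.e., for all small positive $\lambda$ there exists a negative eigenvalue $e_\lambda$ of $H_\lambda$ such that $e_\lambda\to0$ as $\lambda\to0$), if $$\int_{\mathbb{R}}(V v_*+V_1u)\,u\,dx<0.$$ Moreover, the threshold eigenvalue $e_\lambda$ admits the asymptotics $$e_\lambda=-\frac{\lambda^4}{(\theta^2+1)^2}\bigg(\int_{\mathbb{R}}V v_* u\,dx+\int_{\mathbb{R}} V_1u^2\,dx\bigg)^2+o(\lambda^4)\quad\text{as }\lambda\to 0.$$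
   Context: The operator $H_\lambda=-\frac{d^2}{dx^2}+U+\lambda V_\lambda$ acts in $L_2(\mathbb{R})$ with domain $W_2^2(\mathbb{R})$ (the Sobolev space), where the parameter $\lambda$ is positive. The operator $-\frac{d^2}{dx^2}+U$ possesses a zero-energy resonance if there exists a nontrivial solution $u$ of $-u''+Uu=0$ that is bounded on the whole line; such $u$ is called a half-bound state. A half-bound state is constant to the left and to the right of the support of $U$, and both limits $\lim_{x\to\pm\infty}u(x)$ are nonzero. It is normalized if $\lim_{x\to-\infty}u(x)=1$. For the normalized half-bound state put $\theta:=\lim_{x\to+\infty}u(x)$. The function $v_*$ is the solution of $-v''+Uv=-Vu$ on $\mathbb{R}$ which vanishes to the left of the supports of $U$ and $V$.
   Formalization: The supports of V_λ are assumed to lie in one common compact set for all small λ; with only individually compact supports the asymptotics can fail (U=V=0, V_1=-1_[0,1], V_λ=λV_1-λ^{7/4}1_[2,2+1/λ] gives e_λ of order λ^{7/2}). *)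

theory Defs
  imports "HOL-Analysis.Analysis" "HOL-Library.Landau_Symbols"
begin

text \<open>
  Functions on the line are concrete Lebesgue measurable functions; the null-set
  identifications of the Lebesgue spaces are expressed by ``almost everywhere''.
\<close>

definition in_Linf :: "(real \<Rightarrow> real) \<Rightarrow> bool" where
  "in_Linf f \<longleftrightarrow> f \<in> borel_measurable lebesgue \<and> (\<exists>C. AE x in lebesgue. \<bar>f x\<bar> \<le> C)"

definition in_L2 :: "(real \<Rightarrow> 'a::euclidean_space) \<Rightarrow> bool" where
  "in_L2 f \<longleftrightarrow> f \<in> borel_measurable lebesgue \<and> integrable lebesgue (\<lambda>x. (norm (f x))\<^sup>2)"

definition L2_norm :: "(real \<Rightarrow> real) \<Rightarrow> real" where
  "L2_norm f = sqrt (LINT x|lebesgue. \<bar>f x\<bar>\<^sup>2)"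

text \<open>
  The support of a function defined up to null sets: the complement of the largest
  open set on which the function vanishes almost everywhere.
\<close>

definition ess_support :: "(real \<Rightarrow> real) \<Rightarrow> real set" where
  "ess_support f = {x. \<forall>r>0. \<not> (AE y in lebesgue. y \<in> ball x r \<longrightarrow> f y = 0)}"

text \<open>
  \<open>f\<close> is locally absolutely continuous, with almost-everywhere derivative \<open>g\<close>:
  \<open>g\<close> is locally integrable and \<open>f\<close> is an indefinite Lebesgue integral of \<open>g\<close>.
\<close>

definition has_ac_deriv ::
    "(real \<Rightarrow> 'a::euclidean_space) \<Rightarrow> (real \<Rightarrow> 'a) \<Rightarrow> bool" where
  "has_ac_deriv f g \<longleftrightarrow>
     (\<forall>a b. a \<le> b \<longrightarrow>
        set_integrable lebesgue {a..b} g \<and> f b - f a = (LINT x:{a..b}|lebesgue. g x))"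

text \<open>
  The Sobolev space of order two over the complex space of square integrable functions.
  It consists of the continuously differentiable representatives of its classes.
\<close>

definition sobolev_W22 :: "(real \<Rightarrow> complex) set" where
  "sobolev_W22 =
     {f. in_L2 f \<and> (\<exists>f' f''. has_ac_deriv f f' \<and> has_ac_deriv f' f'' \<and> in_L2 f' \<and> in_L2 f'')}"

text \<open>
  The graph of the operator \<open>- d\<^sup>2/dx\<^sup>2 + W\<close> with domain \<^const>\<open>sobolev_W22\<close>. The derivative
  \<open>f'\<close> is unique because it is continuous, and \<open>f''\<close> is unique up to null sets.
\<close>

definition schrodinger_op_graph ::
    "(real \<Rightarrow> real) \<Rightarrow> (real \<Rightarrow> complex) \<Rightarrow> (real \<Rightarrow> complex) \<Rightarrow> bool" where
  "schrodinger_op_graph W f h \<longleftrightarrow>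
     f \<in> sobolev_W22 \<and> in_L2 h \<and>
     (\<exists>f' f''. has_ac_deriv f f' \<and> has_ac_deriv f' f'' \<and>
        (AE x in lebesgue. h x = - f'' x + of_real (W x) * f x))"

definition schrodinger_eigenvalue :: "(real \<Rightarrow> real) \<Rightarrow> complex \<Rightarrow> bool" where
  "schrodinger_eigenvalue W E \<longleftrightarrow>
     (\<exists>f. \<not> (AE x in lebesgue. f x = 0) \<and> schrodinger_op_graph W f (\<lambda>x. E * f x))"

text \<open>Solutions of \<open>- y'' + W y = g\<close> on the whole line, in the sense of Caratheodory.\<close>

definition schrodinger_solution ::
    "(real \<Rightarrow> real) \<Rightarrow> (real \<Rightarrow> real) \<Rightarrow> (real \<Rightarrow> real) \<Rightarrow> bool" where
  "schrodinger_solution W g y \<longleftrightarrow>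
     (\<exists>y' y''. has_ac_deriv y y' \<and> has_ac_deriv y' y'' \<and>
        (AE x in lebesgue. - y'' x + W x * y x = g x))"

definition half_bound_state :: "(real \<Rightarrow> real) \<Rightarrow> (real \<Rightarrow> real) \<Rightarrow> bool" where
  "half_bound_state U u \<longleftrightarrow>
     schrodinger_solution U (\<lambda>x. 0) u \<and> (\<exists>x. u x \<noteq> 0) \<and> bounded (range u)"

definition normalized_half_bound_state :: "(real \<Rightarrow> real) \<Rightarrow> (real \<Rightarrow> real) \<Rightarrow> bool" where
  "normalized_half_bound_state U u \<longleftrightarrow> half_bound_state U u \<and> (u \<longlongrightarrow> 1) at_bot"

text \<open>
  Here \<open>W l\<close> is the full potential of the operator at parameter value \<open>l\<close>. Only the
  germ of \<open>e\<close> at \<open>0\<close> from the right matters.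
\<close>

definition threshold_eigenvalue :: "(real \<Rightarrow> real \<Rightarrow> real) \<Rightarrow> (real \<Rightarrow> real) \<Rightarrow> bool" where
  "threshold_eigenvalue W e \<longleftrightarrow>
     (\<forall>\<^sub>F l in at_right 0. e l < 0 \<and> schrodinger_eigenvalue (W l) (of_real (e l))) \<and>
     (e \<longlongrightarrow> 0) (at_right 0)"

definition zero_coupling_constant_threshold :: "(real \<Rightarrow> real \<Rightarrow> real) \<Rightarrow> bool" where
  "zero_coupling_constant_threshold W \<longleftrightarrow> (\<exists>e. threshold_eigenvalue W e)"

end

theory Submission
  imports Defs
begin

text \<open>
  All potentials live in a bounded interval $[a,b]$, outside which an eigenfunction with energy
  $e = -k^2$, $k > 0$, solves $y'' = k^2 y$. Square integrability leaves only $e^{k(x-a)}$ on the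
  left and $e^{-k(x-b)}$ on the right. So $-k^2$ is an eigenvalue of $-d^2/dx^2 + W$ exactly when
  the solution with data $y(a) = 1$, $y'(a) = k$ (the Jost solution coming from the left) satisfies
  $F(k) = y'(b) + k y(b) = 0$; these are the lemmas \<open>eigenvalue_imp_jost_root\<close> and
  \<open>jost_root_imp_eigenvalue\<close>. The spectral problem thus becomes a scalar equation for \<open>k\<close>.

  The half-bound state is constant outside $[a,b]$, so $u(a) = 1$, $u(b) = \<theta>$ and
  $u'(a) = u'(b) = 0$. For $W = U + \<lambda> V_\<lambda>$ the Wronskian of \<open>y\<close> and \<open>u\<close> gives
  \[ \<theta> F(k) = k + k \<theta> y(b) + \int_a^b (\<lambda> V_\<lambda> + k^2) y u \, dx. \]
  A Gronwall estimate with the fixed potential \<open>U\<close>, applied twice, yields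
  $y - u = O(\<lambda> + k)$ and then $y - u - \<lambda> v = O(k + \<lambda>^2)$. Substituting this and
  $V_\<lambda> = V + \<lambda> V_1 + o(\<lambda>)$, the term of order \<open>\<lambda>\<close> is $\int V u^2 = 0$ and
  \[ \<theta> F(k) = k (1 + \<theta>^2) + \<lambda>^2 B + o(k + \<lambda>^2), \qquad
     B = \int_a^b (V v + V_1 u) u \, dx \]
  uniformly for small \<open>k\<close> (\<open>jost_function_estimate\<close>, \<open>jost_function_expansion\<close>).

  Since $B < 0$, the leading part changes sign at $k = c \<lambda>^2$ with $c = -B/(1+\<theta>^2) > 0$.
  \<open>F\<close> is continuous in \<open>k\<close>, and the intermediate value theorem on
  $[c\<lambda>^2/2, 2c\<lambda>^2]$ produces an eigenvalue (\<open>jost_function_root\<close>). Conversely, every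
  eigenvalue that tends to zero comes from a root with $k \to 0$, and the expansion forces
  $k = c \<lambda>^2 + o(\<lambda>^2)$, hence $e = -k^2 = -c^2 \<lambda>^4 + o(\<lambda>^4)$.
\<close>

section \<open>Calculus of locally absolutely continuous functions\<close>

definition locally_integrable :: "(real \<Rightarrow> 'a::euclidean_space) \<Rightarrow> bool" where
  "locally_integrable g \<longleftrightarrow> (\<forall>a b. g absolutely_integrable_on {a..b})"

text \<open>
  Passing to the Henstock--Kurzweil integral gives access to its interval calculus (combination of
  intervals, continuity of indefinite integrals), while absolute integrability is kept as a separate
  condition on the derivative.
\<close>

lemma has_ac_deriv_iff:
  "has_ac_deriv f g \<longleftrightarrow>
     locally_integrable g \<and> (\<forall>a b. a \<le> b \<longrightarrow> f b - f a = integral {a..b} g)"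
proof -
  have "g absolutely_integrable_on {a..b}" if "\<forall>a b. a \<le> b \<longrightarrow> g absolutely_integrable_on {a..b}"
    for a b
    using that by (cases "a \<le> b") (auto simp: set_integrable_def)
  then show ?thesis
    unfolding has_ac_deriv_def locally_integrable_def
    by (metis set_lebesgue_integral_eq_integral(2))
qed

lemma locally_integrable_integrable_on:
  "locally_integrable g \<Longrightarrow> g integrable_on {a..b}"
  unfolding locally_integrable_def by (blast intro: set_lebesgue_integral_eq_integral(1))

lemma locally_integrable_abs:
  fixes g :: "real \<Rightarrow> real"
  shows "locally_integrable g \<Longrightarrow> locally_integrable (\<lambda>x. \<bar>g x\<bar>)"
  unfolding locally_integrable_def by (simp add: set_integrable_abs)

lemma locally_integrable_add:
  "locally_integrable f \<Longrightarrow> locally_integrable g \<Longrightarrow> locally_integrable (\<lambda>x. f x + g x)"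
  unfolding locally_integrable_def by (simp add: set_integral_add)

lemma locally_integrable_diff:
  "locally_integrable f \<Longrightarrow> locally_integrable g \<Longrightarrow> locally_integrable (\<lambda>x. f x - g x)"
  unfolding locally_integrable_def by (simp add: set_integral_diff)

lemma locally_integrable_bounded_linear:
  "bounded_linear h \<Longrightarrow> locally_integrable f \<Longrightarrow> locally_integrable (\<lambda>x. h (f x))"
  unfolding locally_integrable_def using absolutely_integrable_linear[unfolded o_def] by blast

lemma locally_integrable_continuous:
  "continuous_on UNIV f \<Longrightarrow> locally_integrable f"
  unfolding locally_integrable_def
  by (blast intro: absolutely_integrable_continuous_real continuous_on_subset)

lemma locally_integrable_measurable_bound:
  fixes f :: "real \<Rightarrow> 'a::euclidean_space" and g :: "real \<Rightarrow> real"
  assumes "locally_integrable g" "f \<in> borel_measurable lebesgue"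
    and "AE x in lebesgue. norm (f x) \<le> g x"
  shows "locally_integrable f"
  unfolding locally_integrable_def
proof (intro allI)
  fix a b
  have "set_integrable lebesgue {a..b} g"
    using assms(1) by (simp add: locally_integrable_def)
  moreover have "set_borel_measurable lebesgue {a..b} f"
    unfolding set_borel_measurable_def by (intro borel_measurable_scaleR borel_measurable_indicator assms) simp_all
  moreover have "AE x in lebesgue. x \<in> {a..b} \<longrightarrow> norm (f x) \<le> norm (g x)"
    using assms(3) by eventually_elim auto
  ultimately show "set_integrable lebesgue {a..b} f"
    by (rule set_integrable_bound)
qed

lemma locally_integrable_cong_AE:
  assumes "AE x in lebesgue. f x = g x" "locally_integrable f"
  shows "locally_integrable g"
proof -
  obtain N where N: "negligible N" "{x. \<not> f x = g x} \<subseteq> N"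
    using assms(1) unfolding eventually_ae_filter_negligible by blast
  show ?thesis
    unfolding locally_integrable_def
  proof (intro allI)
    fix a b
    have "f absolutely_integrable_on {a..b}"
      using assms(2) by (simp add: locally_integrable_def)
    then show "g absolutely_integrable_on {a..b}"
      by (rule absolutely_integrable_spike[OF _ N(1)]) (use N(2) in force)
  qed
qed

lemma integral_cong_AE_Icc:
  fixes f g :: "real \<Rightarrow> 'a::euclidean_space"
  assumes "AE x in lebesgue. x \<in> {a..b} \<longrightarrow> f x = g x"
  shows "integral {a..b} f = integral {a..b} g"
proof -
  obtain N where N: "negligible N" "{x. \<not> (x \<in> {a..b} \<longrightarrow> f x = g x)} \<subseteq> N"
    using assms(1) unfolding eventually_ae_filter_negligible by blast
  show ?thesis
    by (rule integral_spike[OF N(1)]) (use N(2) in auto)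
qed

text \<open>
  Almost-everywhere hypotheses on the Henstock--Kurzweil side are reduced to pointwise ones by
  changing the integrand on a negligible set.
\<close>

lemma integral_le_AE_Icc:
  fixes f g :: "real \<Rightarrow> real"
  assumes "f integrable_on {a..b}" "g integrable_on {a..b}"
    and "AE x in lebesgue. x \<in> {a..b} \<longrightarrow> f x \<le> g x"
  shows "integral {a..b} f \<le> integral {a..b} g"
proof -
  obtain N where N: "negligible N" "{x. \<not> (x \<in> {a..b} \<longrightarrow> f x \<le> g x)} \<subseteq> N"
    using assms(3) unfolding eventually_ae_filter_negligible by blast
  have "integral {a..b} f = integral {a..b} (\<lambda>x. if x \<in> N then g x else f x)"
    by (rule integral_spike[OF N(1)]) auto
  also have "\<dots> \<le> integral {a..b} g"
  proof (rule integral_le)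
    show "(\<lambda>x. if x \<in> N then g x else f x) integrable_on {a..b}"
      by (rule integrable_spike[OF assms(1) N(1)]) auto
  qed (use N(2) assms(2) in auto)
  finally show ?thesis .
qed

lemma abs_integral_le_AE_Icc:
  fixes f g :: "real \<Rightarrow> real"
  assumes "locally_integrable f" "locally_integrable g"
    and "AE x in lebesgue. x \<in> {a..b} \<longrightarrow> \<bar>f x\<bar> \<le> g x"
  shows "\<bar>integral {a..b} f\<bar> \<le> integral {a..b} g"
proof -
  have "\<bar>integral {a..b} f\<bar> \<le> integral {a..b} (\<lambda>x. \<bar>f x\<bar>)"
    using assms(1) locally_integrable_abs[OF assms(1)]
    by (metis integral_norm_bound_integral locally_integrable_integrable_on order_refl real_norm_def)
  also have "\<dots> \<le> integral {a..b} g"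
    by (intro integral_le_AE_Icc locally_integrable_integrable_on locally_integrable_abs assms)
  finally show ?thesis .
qed

lemma has_ac_deriv_cong_AE:
  fixes f :: "real \<Rightarrow> 'a::euclidean_space"
  assumes "has_ac_deriv f g" "AE x in lebesgue. g x = h x"
  shows "has_ac_deriv f h"
proof -
  have "integral {a..b} g = integral {a..b} h" for a b
    by (rule integral_cong_AE_Icc) (use assms(2) in \<open>eventually_elim, auto\<close>)
  then show ?thesis
    using assms locally_integrable_cong_AE[OF assms(2)] by (auto simp: has_ac_deriv_iff)
qed

lemma has_ac_deriv_continuous:
  fixes f :: "real \<Rightarrow> 'a::euclidean_space"
  assumes "has_ac_deriv f g"
  shows "continuous_on S f"
proof -
  have "isCont f x" for x
  proof -
    have "continuous_on {x-1..x+1} (\<lambda>t. f (x-1) + integral {x-1..t} g)"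
      using assms
      by (intro continuous_intros indefinite_integral_continuous_1 locally_integrable_integrable_on)
        (simp add: has_ac_deriv_iff)
    moreover have "f (x-1) + integral {x-1..t} g = f t" if "t \<in> {x-1..x+1}" for t
    proof -
      have "f t - f (x-1) = integral {x-1..t} g"
        using assms that unfolding has_ac_deriv_iff by auto
      then show ?thesis by (simp add: algebra_simps)
    qed
    ultimately have "continuous_on {x-1..x+1} f"
      by (rule continuous_on_eq)
    then have "continuous_on {x-1<..<x+1} f"
      by (rule continuous_on_subset) auto
    then show ?thesis
      by (simp add: continuous_on_eq_continuous_at)
  qed
  then show ?thesis
    by (simp add: continuous_at_imp_continuous_on)
qed

lemma has_ac_deriv_has_real_derivative:
  fixes f :: "real \<Rightarrow> real"
  assumes "has_ac_deriv f g" "continuous_on UNIV g"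
  shows "(f has_real_derivative g x) (at x)"
proof -
  have "((\<lambda>t. integral {x-1..t} g) has_real_derivative g x) (at x within {x-1..x+1})"
    by (rule integral_has_real_derivative) (use assms(2) in \<open>auto intro: continuous_on_subset\<close>)
  then have "((\<lambda>t. f (x-1) + integral {x-1..t} g) has_real_derivative g x) (at x within {x-1..x+1})"
    by (auto intro!: derivative_eq_intros)
  then have "(f has_real_derivative g x) (at x within {x-1..x+1})"
  proof (rule has_field_derivative_transform_within[of _ _ _ _ 1])
    fix t assume "t \<in> {x-1..x+1}"
    then have "f t - f (x-1) = integral {x-1..t} g"
      using assms(1) unfolding has_ac_deriv_iff by auto
    then show "f (x-1) + integral {x-1..t} g = f t" by simp
  qed auto
  then show ?thesis
    by (simp add: at_within_Icc_at)
qed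

lemma has_real_derivative_has_ac_deriv:
  fixes f :: "real \<Rightarrow> real"
  assumes "\<And>x. (f has_real_derivative g x) (at x)" "continuous_on UNIV g"
  shows "has_ac_deriv f g"
proof -
  have "(g has_integral f b - f a) {a..b}" if "a \<le> b" for a b
    using that assms(1)
    by (intro fundamental_theorem_of_calculus)
      (auto simp: has_real_derivative_iff_has_vector_derivative[symmetric] intro: has_field_derivative_at_within)
  then show ?thesis
    using assms(2) by (force simp: has_ac_deriv_iff locally_integrable_continuous dest: integral_unique)
qed

lemma has_ac_deriv_add:
  fixes f g :: "real \<Rightarrow> 'a::euclidean_space"
  assumes "has_ac_deriv f f'" "has_ac_deriv g g'"
  shows "has_ac_deriv (\<lambda>x. f x + g x) (\<lambda>x. f' x + g' x)"
  using assms unfolding has_ac_deriv_iff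
  by (auto simp: locally_integrable_add integral_add locally_integrable_integrable_on)
     (metis add_diff_add)

lemma has_ac_deriv_bounded_linear:
  fixes f :: "real \<Rightarrow> 'a::euclidean_space" and h :: "'a \<Rightarrow> 'b::euclidean_space"
  assumes h: "bounded_linear h" and f: "has_ac_deriv f f'"
  shows "has_ac_deriv (\<lambda>x. h (f x)) (\<lambda>x. h (f' x))"
proof -
  interpret bounded_linear h by fact
  have "integral {a..b} (\<lambda>x. h (f' x)) = h (integral {a..b} f')" for a b
    using integral_linear[OF locally_integrable_integrable_on h, of f' a b] f
    by (simp add: has_ac_deriv_iff o_def)
  then show ?thesis
    using f h by (auto simp: has_ac_deriv_iff locally_integrable_bounded_linear diff[symmetric])
qed

lemma has_ac_deriv_cmult:
  fixes f :: "real \<Rightarrow> real"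
  shows "has_ac_deriv f f' \<Longrightarrow> has_ac_deriv (\<lambda>x. c * f x) (\<lambda>x. c * f' x)"
  by (rule has_ac_deriv_bounded_linear[OF bounded_linear_mult_right])

lemma has_ac_deriv_diff:
  fixes f g :: "real \<Rightarrow> real"
  assumes "has_ac_deriv f f'" "has_ac_deriv g g'"
  shows "has_ac_deriv (\<lambda>x. f x - g x) (\<lambda>x. f' x - g' x)"
  using has_ac_deriv_add[OF assms(1) has_ac_deriv_cmult[OF assms(2), of "-1"]] by simp

lemma locally_integrable_mult_continuous:
  fixes f g :: "real \<Rightarrow> real"
  assumes f: "locally_integrable f" and g: "continuous_on UNIV g"
  shows "locally_integrable (\<lambda>x. f x * g x)"
  unfolding locally_integrable_def
proof (intro allI)
  fix a b :: real
  have gab: "continuous_on {a..b} g"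
    using g continuous_on_subset by blast
  have "bounded (g ` {a..b})"
    by (rule compact_imp_bounded[OF compact_continuous_image[OF gab]]) auto
  then obtain B where B: "\<And>x. x \<in> {a..b} \<Longrightarrow> \<bar>g x\<bar> \<le> B"
    unfolding bounded_iff by (metis image_eqI real_norm_def)
  have fab: "f absolutely_integrable_on {a..b}"
    using f by (simp add: locally_integrable_def)
  have "(\<lambda>x. B * \<bar>f x\<bar>) integrable_on {a..b}"
    using locally_integrable_integrable_on[OF locally_integrable_abs[OF f], of a b]
    by (rule integrable_on_mult_right)
  moreover have "(\<lambda>x. f x * g x) \<in> borel_measurable (lebesgue_on {a..b})"
    using fab gab
    by (intro borel_measurable_times continuous_imp_measurable_on_sets_lebesgue
        absolutely_integrable_imp_borel_measurable) auto
  ultimately show "(\<lambda>x. f x * g x) absolutely_integrable_on {a..b}"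
    using B
    by (intro measurable_bounded_by_integrable_imp_absolutely_integrable[where g="\<lambda>x. B * \<bar>f x\<bar>"])
      (auto simp: abs_mult mult.commute[of B] intro!: mult_left_mono)
qed

text \<open>
  The derivatives exist only almost everywhere, so the pointwise product rule does not suffice.
  Instead consider the defect $f g |_s^t - \int_s^t (f' g + f g')$. It is additive over adjacent
  intervals, and on a short interval it is at most the oscillation of \<open>f\<close> and \<open>g\<close> times
  $\int_s^t (|f'| + |g'|)$. Compactness of the interval, in the form of the rule \<open>Bolzano\<close>,
  makes the defect smaller than any positive multiple of the latter integral.
\<close>

lemma has_ac_deriv_mult:
  fixes f g :: "real \<Rightarrow> real"
  assumes f: "has_ac_deriv f f'" and g: "has_ac_deriv g g'"
  shows "has_ac_deriv (\<lambda>x. f x * g x) (\<lambda>x. f' x * g x + f x * g' x)"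
proof -
  have cf: "continuous_on UNIV f" and cg: "continuous_on UNIV g"
    using assms has_ac_deriv_continuous by blast+
  have lf: "locally_integrable f'" and lg: "locally_integrable g'"
    using assms by (auto simp: has_ac_deriv_iff)
  define h where "h x = f' x * g x + f x * g' x" for x
  define m where "m x = \<bar>f' x\<bar> + \<bar>g' x\<bar>" for x
  have lh: "locally_integrable h"
    unfolding h_def using locally_integrable_mult_continuous[OF lf cg]
      locally_integrable_mult_continuous[OF lg cf]
    by (intro locally_integrable_add) (auto simp: mult.commute)
  have lm: "locally_integrable m"
    unfolding m_def by (intro locally_integrable_add locally_integrable_abs lf lg)
  note io = locally_integrable_integrable_on
  have main: "\<bar>f b * g b - f a * g a - integral {a..b} h\<bar> \<le> e * integral {a..b} m"
    if "a \<le> b" "e > 0" for a b e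
    using \<open>a \<le> b\<close>
  proof (induct rule: Bolzano)
    case (trans a b c)
    have "integral {a..c} h = integral {a..b} h + integral {b..c} h"
      "integral {a..c} m = integral {a..b} m + integral {b..c} m"
      using trans by (auto simp: Henstock_Kurzweil_Integration.integral_combine io lh lm)
    then show ?case using trans(1,2) by (simp add: algebra_simps)
  next
    case (local x)
    have "isCont f x" "isCont g x"
      using cf cg by (auto simp: continuous_on_eq_continuous_at)
    then obtain d1 d2 where d: "d1 > 0" "d2 > 0"
      and d1: "\<And>y. \<bar>y - x\<bar> < d1 \<Longrightarrow> \<bar>f y - f x\<bar> < e/2"
      and d2: "\<And>y. \<bar>y - x\<bar> < d2 \<Longrightarrow> \<bar>g y - g x\<bar> < e/2"
      using \<open>e > 0\<close> unfolding continuous_at_eps_delta dist_real_def by (metis half_gt_zero)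
    show ?case
    proof (intro exI[of _ "min d1 d2"] conjI allI impI)
      fix s t assume st: "s \<le> x \<and> x \<le> t \<and> t - s < min d1 d2"
      have F: "f t - f s = integral {s..t} f'" and G: "g t - g s = integral {s..t} g'"
        using f g st by (auto simp: has_ac_deriv_iff)
      \<comment> \<open>the defect on a short interval is controlled by the oscillation of the two factors\<close>
      have "f t * g t - f s * g s - integral {s..t} h
          = integral {s..t} (\<lambda>r. f' r * g t + f s * g' r) - integral {s..t} h"
        using io[OF lf] io[OF lg]
        by (simp add: integral_add F[symmetric] G[symmetric] integrable_on_mult_left
            integrable_on_mult_right algebra_simps)
      also have "\<dots> = integral {s..t} (\<lambda>r. (f' r * g t + f s * g' r) - h r)"
        using io[OF lf] io[OF lg] io[OF lh]
        by (intro integral_diff[symmetric] integrable_add integrable_on_mult_left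
            integrable_on_mult_right) auto
      also have "\<bar>\<dots>\<bar> \<le> integral {s..t} (\<lambda>r. e * m r)"
      proof (rule abs_integral_le_AE_Icc)
        show "locally_integrable (\<lambda>r. f' r * g t + f s * g' r - h r)"
          using lf lg lh
          by (intro locally_integrable_add locally_integrable_diff
              locally_integrable_bounded_linear[OF bounded_linear_mult_left]
              locally_integrable_bounded_linear[OF bounded_linear_mult_right])
        show "locally_integrable (\<lambda>r. e * m r)"
          using lm locally_integrable_bounded_linear[OF bounded_linear_mult_right] by blast
        show "AE r in lebesgue. r \<in> {s..t} \<longrightarrow> \<bar>f' r * g t + f s * g' r - h r\<bar> \<le> e * m r"
        proof (intro AE_I2 impI)
          fix r assume r: "r \<in> {s..t}"
          then have "\<bar>s - x\<bar> < d1" "\<bar>r - x\<bar> < d1" "\<bar>t - x\<bar> < d2" "\<bar>r - x\<bar> < d2"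
            using st by auto
          then have "\<bar>g t - g r\<bar> \<le> e" "\<bar>f s - f r\<bar> \<le> e"
            using d1[of s] d1[of r] d2[of t] d2[of r] by linarith+
          then have "\<bar>f' r * (g t - g r)\<bar> \<le> \<bar>f' r\<bar> * e" "\<bar>(f s - f r) * g' r\<bar> \<le> e * \<bar>g' r\<bar>"
            by (auto simp: abs_mult intro: mult_left_mono mult_right_mono)
          moreover have "f' r * g t + f s * g' r - h r = f' r * (g t - g r) + (f s - f r) * g' r"
            by (simp add: h_def algebra_simps)
          ultimately show "\<bar>f' r * g t + f s * g' r - h r\<bar> \<le> e * m r"
            by (simp add: m_def algebra_simps)
        qed
      qed
      finally show "\<bar>f t * g t - f s * g s - integral {s..t} h\<bar> \<le> e * integral {s..t} m"
        by simp
    qed (use d in auto)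
  qed
  have "f b * g b - f a * g a = integral {a..b} h" if "a \<le> b" for a b
  proof -
    have m0: "0 \<le> integral {a..b} m"
      by (rule integral_nonneg) (auto simp: io lm m_def)
    have "\<bar>f b * g b - f a * g a - integral {a..b} h\<bar> \<le> e" if "e > 0" for e
    proof -
      have "\<bar>f b * g b - f a * g a - integral {a..b} h\<bar>
          \<le> (e / (integral {a..b} m + 1)) * integral {a..b} m"
        using main[OF \<open>a \<le> b\<close>, of "e / (integral {a..b} m + 1)"] that m0 by simp
      also have "\<dots> \<le> e" using that m0 by (simp add: field_simps)
      finally show ?thesis .
    qed
    then have "\<bar>f b * g b - f a * g a - integral {a..b} h\<bar> \<le> 0"
      by (rule field_le_epsilon[of _ 0, simplified])
    then show ?thesis by simp
  qed
  then show ?thesis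
    unfolding has_ac_deriv_iff h_def[symmetric] using lh by auto
qed

lemma has_ac_deriv_zero_imp_eq:
  fixes f :: "real \<Rightarrow> 'a::euclidean_space"
  assumes "has_ac_deriv f g" "AE x in lebesgue. x \<in> {s..t} \<longrightarrow> g x = 0" "s \<le> t"
  shows "f t = f s"
proof -
  have "f t - f s = integral {s..t} g"
    using assms(1,3) by (auto simp: has_ac_deriv_iff)
  then show ?thesis
    using integral_cong_AE_Icc[OF assms(2)] by simp
qed

lemma has_ac_deriv_exp: "has_ac_deriv (\<lambda>x. exp (c * (x - a))) (\<lambda>x. c * exp (c * (x - a)))"
  by (rule has_real_derivative_has_ac_deriv)
    (auto intro!: derivative_eq_intros continuous_intros)

text \<open>
  With the integrating factor $e^{-c(x-s)}$ the product rule turns $p' = c p$ into a vanishing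
  derivative. This is the uniqueness statement that identifies solutions outside the support of the
  potential.
\<close>

lemma linear_ac_ode_exp:
  fixes p :: "real \<Rightarrow> real"
  assumes "has_ac_deriv p q" "AE x in lebesgue. x \<in> {s..t} \<longrightarrow> q x = c * p x" "s \<le> t"
  shows "p t = p s * exp (c * (t - s))"
proof -
  have "has_ac_deriv (\<lambda>x. p x * exp (- c * (x - s)))
      (\<lambda>x. q x * exp (- c * (x - s)) + p x * (- c * exp (- c * (x - s))))"
    by (intro has_ac_deriv_mult has_ac_deriv_exp assms)
  moreover have "AE x in lebesgue. x \<in> {s..t} \<longrightarrow>
      q x * exp (- c * (x - s)) + p x * (- c * exp (- c * (x - s))) = 0"
    using assms(2) by eventually_elim auto
  ultimately have "p t * exp (- c * (t - s)) = p s * exp (- c * (s - s))"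
    using \<open>s \<le> t\<close> by (rule has_ac_deriv_zero_imp_eq)
  then show ?thesis
    by (simp add: exp_diff field_simps)
qed

section \<open>Gronwall estimates and Caratheodory systems\<close>

text \<open>
  The quantity $(A + L \int_a^t N) e^{-L(t-a)}$ is nonincreasing.
\<close>

lemma gronwall_integral:
  fixes N :: "real \<Rightarrow> real"
  assumes "continuous_on {a..b} N" "0 \<le> L"
    and bound: "\<And>t. t \<in> {a..b} \<Longrightarrow> N t \<le> A + L * integral {a..t} N"
    and x: "x \<in> {a..b}"
  shows "N x \<le> A * exp (L * (x - a))"
proof -
  define \<psi> where "\<psi> t = (A + L * integral {a..t} N) * exp (- L * (t - a))" for t
  have cont: "continuous_on {a..b} \<psi>"
    unfolding \<psi>_def
    by (intro continuous_intros indefinite_integral_continuous_1 integrable_continuous_real assms)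
  have "\<psi> x \<le> \<psi> a"
  proof (rule DERIV_nonpos_imp_decreasing_open[of a x \<psi>])
      fix t assume t: "a < t" "t < x"
      have "((\<lambda>x. integral {a..x} N) has_real_derivative N t) (at t within {a..b})"
        by (rule integral_has_real_derivative) (use assms t x in auto)
      then have I: "((\<lambda>x. integral {a..x} N) has_real_derivative N t) (at t)"
        using t x by (simp add: at_within_Icc_at)
      have "(\<psi> has_real_derivative
          L * (N t - (A + L * integral {a..t} N)) * exp (- L * (t - a))) (at t)"
        unfolding \<psi>_def
        by (rule derivative_eq_intros I refl | simp add: algebra_simps)+
      moreover have "L * (N t - (A + L * integral {a..t} N)) * exp (- L * (t - a)) \<le> 0"
        using bound[of t] t x \<open>0 \<le> L\<close> by (intro mult_nonpos_nonneg mult_nonneg_nonpos) auto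
      ultimately show "\<exists>y. (\<psi> has_real_derivative y) (at t) \<and> y \<le> 0" by blast
  next
    show "continuous_on {a..x} \<psi>" by (rule continuous_on_subset[OF cont]) (use x in auto)
  qed (use x in simp)
  then have "\<psi> x * exp (L * (x - a)) \<le> A * exp (L * (x - a))"
    by (intro mult_right_mono) (auto simp: \<psi>_def)
  moreover have e: "exp (- L * (x - a)) * exp (L * (x - a)) = 1"
    unfolding exp_add[symmetric] by simp
  ultimately have "A + L * integral {a..x} N \<le> A * exp (L * (x - a))"
    by (simp only: \<psi>_def mult.assoc e mult_1_right)
  with bound[OF x] show ?thesis by linarith
qed

text \<open>
  The source term \<open>h\<close> enters only through a bound for its integral. This matters below: the
  perturbation $V_\<lambda> - V - \<lambda> V_1$ is controlled in the mean, not uniformly.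
\<close>

lemma gronwall_second_order:
  fixes y p q h :: "real \<Rightarrow> real"
  assumes y: "has_ac_deriv y p" and p: "has_ac_deriv p q"
    and h: "locally_integrable h" "\<And>x. 0 \<le> h x" "integral {a..b} h \<le> H"
    and C: "0 \<le> C" and q: "AE x in lebesgue. x \<in> {a..b} \<longrightarrow> \<bar>q x\<bar> \<le> C * \<bar>y x\<bar> + h x"
    and x: "x \<in> {a..b}"
  shows "\<bar>y x\<bar> + \<bar>p x\<bar> \<le> (\<bar>y a\<bar> + \<bar>p a\<bar> + H) * exp ((1 + C) * (x - a))"
proof -
  have cy: "continuous_on UNIV y" and cp: "continuous_on UNIV p"
    using y p has_ac_deriv_continuous by blast+
  have lp: "locally_integrable p" and lq: "locally_integrable q"
    using y p by (auto simp: has_ac_deriv_iff)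
  have ly: "locally_integrable y"
    using cy by (rule locally_integrable_continuous)
  note li = locally_integrable_integrable_on and lm = locally_integrable_bounded_linear[OF bounded_linear_mult_right]
  note lh = h(1)
  show ?thesis
  proof (rule gronwall_integral[where N = "\<lambda>x. \<bar>y x\<bar> + \<bar>p x\<bar>" and b = b])
    show "continuous_on {a..b} (\<lambda>x. \<bar>y x\<bar> + \<bar>p x\<bar>)"
      using cy cp by (intro continuous_intros) (auto intro: continuous_on_subset)
    fix t assume t: "t \<in> {a..b}"
    have "y t - y a = integral {a..t} p"
      using y t by (auto simp: has_ac_deriv_iff)
    moreover have "\<bar>integral {a..t} p\<bar> \<le> integral {a..t} (\<lambda>x. \<bar>p x\<bar>)"
      by (intro abs_integral_le_AE_Icc lp locally_integrable_abs) auto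
    ultimately have 1: "\<bar>y t\<bar> \<le> \<bar>y a\<bar> + integral {a..t} (\<lambda>x. \<bar>p x\<bar>)"
      by linarith
    have "p t - p a = integral {a..t} q"
      using p t by (auto simp: has_ac_deriv_iff)
    moreover have "\<bar>integral {a..t} q\<bar> \<le> integral {a..t} (\<lambda>x. C * \<bar>y x\<bar> + h x)"
    proof (intro abs_integral_le_AE_Icc lq locally_integrable_add lm locally_integrable_abs ly lh)
      show "AE x in lebesgue. x \<in> {a..t} \<longrightarrow> \<bar>q x\<bar> \<le> C * \<bar>y x\<bar> + h x"
        using q by eventually_elim (use t in auto)
    qed
    moreover have "integral {a..t} (\<lambda>x. C * \<bar>y x\<bar> + h x)
        = integral {a..t} (\<lambda>x. C * \<bar>y x\<bar>) + integral {a..t} h"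
      by (intro integral_add li lm locally_integrable_abs ly lh)
    moreover have "integral {a..t} h \<le> integral {a..b} h"
      by (rule integral_subset_le) (use t h li in auto)
    ultimately have 2: "\<bar>p t\<bar> \<le> \<bar>p a\<bar> + integral {a..t} (\<lambda>x. C * \<bar>y x\<bar>) + H"
      using h(3) by linarith
    have "integral {a..t} (\<lambda>x. \<bar>p x\<bar>) + integral {a..t} (\<lambda>x. C * \<bar>y x\<bar>)
        = integral {a..t} (\<lambda>x. \<bar>p x\<bar> + C * \<bar>y x\<bar>)"
      by (intro integral_add[symmetric] li lm locally_integrable_abs ly lp)
    also have "\<dots> \<le> integral {a..t} (\<lambda>x. (1 + C) * (\<bar>y x\<bar> + \<bar>p x\<bar>))"
    proof (intro integral_le li locally_integrable_add lm locally_integrable_abs ly lp)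
      fix x
      have "0 \<le> \<bar>y x\<bar> + C * \<bar>p x\<bar>" using C by simp
      then show "\<bar>p x\<bar> + C * \<bar>y x\<bar> \<le> (1 + C) * (\<bar>y x\<bar> + \<bar>p x\<bar>)"
        by (simp add: algebra_simps)
    qed
    finally show "\<bar>y t\<bar> + \<bar>p t\<bar>
        \<le> (\<bar>y a\<bar> + \<bar>p a\<bar> + H) + (1 + C) * integral {a..t} (\<lambda>x. \<bar>y x\<bar> + \<bar>p x\<bar>)"
      using 1 2 by simp
  qed (use C x in auto)
qed

text \<open>
  Because \<open>g\<close> vanishes on the left of \<open>a\<close> and integrals over empty intervals are zero, the
  formula is correct on the whole line, and no oriented integral is needed.
\<close>

lemma has_ac_deriv_indefinite_integral:
  fixes g :: "real \<Rightarrow> 'a::euclidean_space"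
  assumes g: "locally_integrable g" and left: "\<And>t. t < a \<Longrightarrow> g t = 0"
  shows "has_ac_deriv (\<lambda>x. c + integral {a..x} g) g"
proof -
  have "integral {a..t} g - integral {a..s} g = integral {s..t} g" if "s \<le> t" for s t
  proof -
    have zero: "integral {s..r} g = 0" if "r \<le> a" for r
    proof -
      have "integral {s..r} g = integral {s..r} (\<lambda>x. 0)"
        by (rule integral_spike[of "{a}"]) (use left that in auto)
      then show ?thesis by simp
    qed
    consider "a \<le> s" | "s < a" "a \<le> t" | "t < a" using that by linarith
    then show ?thesis
    proof cases
      case 1
      then show ?thesis
        using Henstock_Kurzweil_Integration.integral_combine[of a s t g] that
          locally_integrable_integrable_on[OF g, of a t] by (simp add: algebra_simps)
    next
      case 2
      then show ?thesis
        using Henstock_Kurzweil_Integration.integral_combine[of s a t g] zero[of a]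
          locally_integrable_integrable_on[OF g, of s t] by simp
    next
      case 3
      then show ?thesis
        using that zero[of t] by simp
    qed
  qed
  then show ?thesis
    using g by (simp add: has_ac_deriv_iff)
qed

text \<open>
  Picard iteration, made contracting on the whole half-line at once: in the supremum norm weighted
  with $e^{-M(t-a)}$ the integral operator has Lipschitz constant $L/M < 1$ for $M = L + 1$. The
  weight is 1 on the left of \<open>a\<close>, where the right-hand side vanishes.
\<close>

lemma caratheodory_existence:
  fixes F :: "real \<Rightarrow> 'a::euclidean_space \<Rightarrow> 'a"
  assumes L: "0 \<le> L" and lip: "\<And>t z w. norm (F t z - F t w) \<le> L * norm (z - w)"
    and zero: "\<And>t. F t 0 = 0"
    and meas: "\<And>z. continuous_on UNIV z \<Longrightarrow> (\<lambda>t. F t (z t)) \<in> borel_measurable lebesgue"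
    and left: "\<And>t z. t < a \<Longrightarrow> F t z = 0"
  shows "\<exists>Z. has_ac_deriv Z (\<lambda>t. F t (Z t)) \<and> (\<forall>t\<le>a. Z t = z0)"
proof -
  define M where "M = L + 1"
  have M: "M > 0" "L < M" using L by (auto simp: M_def)
  define \<omega> where "\<omega> t = exp (M * max 0 (t - a))" for t
  have \<omega>_pos: "\<omega> t > 0" for t by (simp add: \<omega>_def)
  have c\<omega>: "continuous_on UNIV \<omega>"
    unfolding \<omega>_def by (intro continuous_intros)
  define G where "G z t = F t (\<omega> t *\<^sub>R z t)" for z :: "real \<Rightarrow> 'a" and t
  define S where "S z x = (1 / \<omega> x) *\<^sub>R (z0 + integral {a..x} (G z))" for z :: "real \<Rightarrow> 'a" and x
  \<comment> \<open>$e^{-M(x-a)} \int_a^x K e^{M(t-a)} \, dt \le K/M$\<close>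
  have weighted: "norm ((1 / \<omega> x) *\<^sub>R integral {a..x} g) \<le> K / M"
    if "locally_integrable g" "\<And>t. norm (g t) \<le> K * \<omega> t" for g :: "real \<Rightarrow> 'a" and K x
  proof -
    have K: "0 \<le> K"
      using that(2)[of a] norm_ge_zero[of "g a"] \<omega>_pos[of a]
      by (metis zero_le_mult_iff order_trans not_less)
    show ?thesis
    proof (cases "a \<le> x")
      case True
      have "((\<lambda>t. exp (M * (t - a))) has_integral exp (M * (x - a)) / M - exp (M * (a - a)) / M) {a..x}"
        using True M
        by (intro fundamental_theorem_of_calculus)
          (auto intro!: derivative_eq_intros simp: has_real_derivative_iff_has_vector_derivative[symmetric])
      then have I: "integral {a..x} (\<lambda>t. K * exp (M * (t - a))) = K * (exp (M * (x - a)) / M - 1 / M)"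
        by (simp add: integral_unique)
      have "norm (integral {a..x} g) \<le> integral {a..x} (\<lambda>t. K * exp (M * (t - a)))"
      proof (rule integral_norm_bound_integral)
        show "g integrable_on {a..x}" using that(1) by (rule locally_integrable_integrable_on)
        show "(\<lambda>t. K * exp (M * (t - a))) integrable_on {a..x}"
          by (intro integrable_continuous_real continuous_intros)
      qed (use that(2) in \<open>auto simp: \<omega>_def max_def split: if_splits\<close>, metis diff_self max_def)
      also have "\<dots> \<le> K * (\<omega> x / M)"
        unfolding I using True M K by (intro mult_left_mono) (auto simp: \<omega>_def max_def)
      finally show ?thesis
        using \<omega>_pos[of x] by (simp add: field_simps)
    qed (use K M in auto)
  qed
  have lG: "locally_integrable (G z)" if "continuous_on UNIV z" for z
  proof (rule locally_integrable_measurable_bound[where g="\<lambda>t. L * norm (\<omega> t *\<^sub>R z t)"])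
    have c: "continuous_on UNIV (\<lambda>t. \<omega> t *\<^sub>R z t)" by (intro continuous_intros c\<omega> that)
    show "locally_integrable (\<lambda>t. L * norm (\<omega> t *\<^sub>R z t))"
      by (intro locally_integrable_continuous continuous_intros c\<omega> that)
    show "G z \<in> borel_measurable lebesgue" unfolding G_def by (rule meas[OF c])
    show "AE x in lebesgue. norm (G z x) \<le> L * norm (\<omega> x *\<^sub>R z x)"
      using lip[of _ _ 0] zero by (intro AE_I2) (metis G_def diff_zero)
  qed
  have acS: "has_ac_deriv (\<lambda>x. z0 + integral {a..x} (G z)) (G z)" if "continuous_on UNIV z" for z
    by (rule has_ac_deriv_indefinite_integral[OF lG[OF that]]) (simp add: G_def left)
  have Sz: "S (apply_bcontfun z) \<in> bcontfun" for z :: "real \<Rightarrow>\<^sub>C 'a"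
  proof (rule bcontfun_normI)
    have cz: "continuous_on UNIV (apply_bcontfun z)" by simp
    show "continuous_on UNIV (S z)"
      unfolding S_def
    proof (intro continuous_on_scaleR continuous_on_divide continuous_on_const c\<omega>)
      show "\<forall>x\<in>UNIV. \<omega> x \<noteq> 0" by (simp add: \<omega>_def)
    qed (rule has_ac_deriv_continuous[OF acS[OF cz]])
    fix x
    have "norm (G z t) \<le> (L * norm z) * \<omega> t" for t
    proof -
      have "norm (G z t) \<le> L * (\<omega> t * norm (z t))"
        using lip[of t "\<omega> t *\<^sub>R z t" 0] zero[of t] \<omega>_pos[of t] by (simp add: G_def)
      also have "\<dots> \<le> L * (\<omega> t * norm z)"
        using L \<omega>_pos[of t] norm_bounded[of z t] by (intro mult_left_mono) auto
      finally show ?thesis by (simp add: algebra_simps)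
    qed
    from weighted[OF lG[OF cz] this, of x]
    have "norm ((1 / \<omega> x) *\<^sub>R integral {a..x} (G z)) \<le> L * norm z / M" .
    moreover have "norm ((1 / \<omega> x) *\<^sub>R z0) \<le> norm z0"
    proof -
      have "1 \<le> \<omega> x" using M by (simp add: \<omega>_def)
      then show ?thesis using mult_left_mono[of 1 "\<omega> x" "norm z0"] \<omega>_pos[of x] by (simp add: field_simps)
    qed
    ultimately show "norm (S z x) \<le> norm z0 + L * norm z / M"
      unfolding S_def scaleR_add_right by (meson add_mono norm_triangle_le)
  qed
  define T where "T z = Bcontfun (S (apply_bcontfun z))" for z :: "real \<Rightarrow>\<^sub>C 'a"
  have T: "apply_bcontfun (T z) = S z" for z
    unfolding T_def using Sz by (simp add: Bcontfun_inverse)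
  have "\<exists>!z. T z = z"
  proof (rule banach_fix_type)
    show "0 \<le> L / M" "L / M < 1" using L M by auto
    show "\<forall>z w. dist (T z) (T w) \<le> L / M * dist z w"
    proof (intro allI dist_bound)
      fix z w :: "real \<Rightarrow>\<^sub>C 'a" and x
      have cz: "continuous_on UNIV (apply_bcontfun z)" "continuous_on UNIV (apply_bcontfun w)" by simp_all
      have "norm (G z t - G w t) \<le> (L * dist z w) * \<omega> t" for t
      proof -
        have "norm (G z t - G w t) \<le> L * (\<omega> t * norm (z t - w t))"
          using lip[of t "\<omega> t *\<^sub>R z t" "\<omega> t *\<^sub>R w t"] \<omega>_pos[of t]
          by (simp add: G_def scaleR_diff_right[symmetric])
        also have "\<dots> \<le> L * (\<omega> t * dist z w)"
          using L \<omega>_pos[of t] dist_bounded[of z t w] by (intro mult_left_mono) (auto simp: dist_norm)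
        finally show ?thesis by (simp add: algebra_simps)
      qed
      from weighted[OF locally_integrable_diff[OF lG[OF cz(1)] lG[OF cz(2)]] this, of x]
      have "norm ((1 / \<omega> x) *\<^sub>R integral {a..x} (\<lambda>t. G z t - G w t)) \<le> L * dist z w / M" .
      moreover have "integral {a..x} (\<lambda>t. G z t - G w t) = integral {a..x} (G z) - integral {a..x} (G w)"
        by (intro integral_diff locally_integrable_integrable_on lG cz)
      ultimately show "dist (T z x) (T w x) \<le> L / M * dist z w"
        by (simp add: T S_def dist_norm scaleR_diff_right[symmetric])
    qed
  qed
  then obtain z where "T z = z" by blast
  then have z: "S z x = z x" for x by (metis T)
  define Z where "Z x = \<omega> x *\<^sub>R z x" for x
  have Z: "Z x = z0 + integral {a..x} (G z)" for x
  proof -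
    have "\<omega> x *\<^sub>R S z x = z0 + integral {a..x} (G z)"
      using \<omega>_pos[of x] by (simp add: S_def)
    then show ?thesis by (simp only: z Z_def)
  qed
  have "Z = (\<lambda>x. z0 + integral {a..x} (G z))" "G z = (\<lambda>t. F t (Z t))"
    by (auto simp only: fun_eq_iff Z G_def) (simp only: Z_def Z[symmetric])
  then have "has_ac_deriv Z (\<lambda>t. F t (Z t))"
    using acS[of z] by simp
  moreover have "\<forall>t\<le>a. Z t = z0"
    by (auto simp: Z le_less)
  ultimately show ?thesis by blast
qed

section \<open>Jost solutions and negative eigenvalues\<close>

text \<open>
  For a potential that vanishes on the left of \<open>a\<close> this is the solution $e^{k(x-a)}$ for $x \le a$,
  continued to the right; \<open>p\<close> is the derivative of \<open>y\<close>. At energy $-k^2$ it is the only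
  candidate for an eigenfunction, up to a factor.
\<close>

definition jost_solution ::
    "(real \<Rightarrow> real) \<Rightarrow> real \<Rightarrow> real \<Rightarrow> (real \<Rightarrow> real) \<Rightarrow> (real \<Rightarrow> real) \<Rightarrow> bool" where
  "jost_solution W a k y p \<longleftrightarrow>
     has_ac_deriv y p \<and> has_ac_deriv p (\<lambda>x. (W x + k\<^sup>2) * y x) \<and> y a = 1 \<and> p a = k"

text \<open>
  Write $y = e^{k(x-a)} g$ and $y' - k y = e^{k(x-a)} r$. Then $g' = r$ and $r' = W g - 2 k r$ with
  $g = 1$, $r = 0$ at \<open>a\<close>. On the left of \<open>a\<close> the constants $g = 1$, $r = 0$ remain a solution,
  so a system that is switched on at \<open>a\<close> yields a solution on the whole line without any gluing.
\<close>

lemma jost_solution_exists: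
  fixes W :: "real \<Rightarrow> real"
  assumes Wm: "W \<in> borel_measurable lebesgue" and WC: "AE x in lebesgue. \<bar>W x\<bar> \<le> C"
    and W0: "AE x in lebesgue. x < a \<longrightarrow> W x = 0"
  shows "\<exists>y p. jost_solution W a k y p"
proof -
  \<comment> \<open>the fixed point argument needs a bound for every \<open>x\<close>, not only for almost every \<open>x\<close>\<close>
  define W' where "W' x = (if \<bar>W x\<bar> \<le> \<bar>C\<bar> then W x else 0)" for x
  have W': "\<bar>W' x\<bar> \<le> \<bar>C\<bar>" for x by (simp add: W'_def)
  have W'_eq: "AE x in lebesgue. W' x = W x"
    using WC by eventually_elim (auto simp: W'_def)
  have [measurable]: "W \<in> borel_measurable lebesgue" by fact
  have [measurable]: "W' \<in> borel_measurable lebesgue" unfolding W'_def[abs_def] by measurable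
  have left: "AE x in lebesgue. x < a \<longrightarrow> W' x = 0"
    using W0 W'_eq by eventually_elim auto
  define F where "F t z = (if t < a then 0 else (snd z, W' t * fst z - 2 * k * snd z))"
    for t and z :: "real \<times> real"
  have "\<exists>Z. has_ac_deriv Z (\<lambda>t. F t (Z t)) \<and> (\<forall>t\<le>a. Z t = (1, 0))"
  proof (rule caratheodory_existence)
    show "0 \<le> 1 + \<bar>C\<bar> + 2 * \<bar>k\<bar>" by simp
    fix t and z w :: "real \<times> real"
    have "norm (F t z - F t w) \<le> norm (snd z - snd w) + norm (W' t * (fst z - fst w) - 2 * k * (snd z - snd w))"
      by (cases "t < a") (auto simp: F_def norm_prod_def algebra_simps sqrt_add_le_add_sqrt
          intro: order_trans[OF sqrt_sum_squares_le_sum_abs])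
    also have "\<dots> \<le> \<bar>snd z - snd w\<bar> + (\<bar>W' t\<bar> * \<bar>fst z - fst w\<bar> + 2 * \<bar>k\<bar> * \<bar>snd z - snd w\<bar>)"
      using abs_triangle_ineq4[of "W' t * (fst z - fst w)" "2 * k * (snd z - snd w)"]
      by (simp add: abs_mult)
    also have "\<dots> \<le> norm (z - w) + (\<bar>C\<bar> * norm (z - w) + 2 * \<bar>k\<bar> * norm (z - w))"
    proof -
      have "\<bar>fst z - fst w\<bar> \<le> norm (z - w)" "\<bar>snd z - snd w\<bar> \<le> norm (z - w)"
        using norm_fst_le[of "fst (z - w)" "snd (z - w)"] norm_snd_le[of "snd (z - w)" "fst (z - w)"]
        unfolding prod.collapse by simp_all
      then show ?thesis
        using W'[of t] by (intro add_mono mult_mono) auto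
    qed
    finally show "norm (F t z - F t w) \<le> (1 + \<bar>C\<bar> + 2 * \<bar>k\<bar>) * norm (z - w)"
      by (simp add: algebra_simps)
  next
    fix z :: "real \<Rightarrow> real \<times> real" assume "continuous_on UNIV z"
    then have "continuous_on UNIV (\<lambda>t. fst (z t))" "continuous_on UNIV (\<lambda>t. snd (z t))"
      by (intro continuous_intros; assumption)+
    then have [measurable]: "(\<lambda>t. fst (z t)) \<in> borel_measurable lebesgue" "(\<lambda>t. snd (z t)) \<in> borel_measurable lebesgue"
      by (auto intro!: borel_measurable_continuous_onI measurable_completion)
    have [measurable]: "{x. x < a} \<in> sets lebesgue" by simp
    have "(\<lambda>t. (snd (z t), W' t * fst (z t) - 2 * k * snd (z t))) \<in> borel_measurable lebesgue"
      by (intro borel_measurable_Pair) measurable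
    then show "(\<lambda>t. F t (z t)) \<in> borel_measurable lebesgue"
      unfolding F_def by (intro measurable_If) auto
  qed (auto simp: F_def zero_prod_def)
  then obtain Z where Z: "has_ac_deriv Z (\<lambda>t. F t (Z t))" and Za: "\<And>t. t \<le> a \<Longrightarrow> Z t = (1, 0)"
    by blast
  have g: "has_ac_deriv (\<lambda>x. fst (Z x)) (\<lambda>x. fst (F x (Z x)))"
    by (rule has_ac_deriv_bounded_linear[OF bounded_linear_fst Z])
  have r: "has_ac_deriv (\<lambda>x. snd (Z x)) (\<lambda>x. snd (F x (Z x)))"
    by (rule has_ac_deriv_bounded_linear[OF bounded_linear_snd Z])
  have g': "has_ac_deriv (\<lambda>x. fst (Z x)) (\<lambda>x. snd (Z x))"
    by (rule has_ac_deriv_cong_AE[OF g]) (auto simp: F_def Za)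
  have r': "has_ac_deriv (\<lambda>x. snd (Z x)) (\<lambda>x. W' x * fst (Z x) - 2 * k * snd (Z x))"
    by (rule has_ac_deriv_cong_AE[OF r]) (use left in \<open>eventually_elim, auto simp: F_def Za\<close>)
  define y where "y x = exp (k * (x - a)) * fst (Z x)" for x
  define p where "p x = exp (k * (x - a)) * (k * fst (Z x) + snd (Z x))" for x
  have "has_ac_deriv y p"
    using has_ac_deriv_mult[OF has_ac_deriv_exp[of k a] g']
    by (simp add: y_def[abs_def] p_def[abs_def] algebra_simps)
  moreover have "has_ac_deriv p (\<lambda>x. (W' x + k\<^sup>2) * y x)"
    using has_ac_deriv_mult[OF has_ac_deriv_exp[of k a] has_ac_deriv_add[OF has_ac_deriv_cmult[OF g', of k] r']]
    by (simp add: y_def[abs_def] p_def[abs_def] algebra_simps power2_eq_square)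
  then have "has_ac_deriv p (\<lambda>x. (W x + k\<^sup>2) * y x)"
    by (rule has_ac_deriv_cong_AE) (use W'_eq in \<open>eventually_elim, simp\<close>)
  ultimately show ?thesis
    using Za[of a] by (intro exI[of _ y] exI[of _ p]) (simp add: jost_solution_def y_def p_def)
qed

lemma square_integrable_not_bounded_below:
  fixes f :: "real \<Rightarrow> real"
  assumes f: "integrable lebesgue (\<lambda>x. (f x)\<^sup>2)" and c: "c > 0"
    and S: "S \<in> sets lebesgue" "\<And>n::nat. \<exists>s. {s..s + real n} \<subseteq> S"
    and ge: "\<And>x. x \<in> S \<Longrightarrow> c \<le> \<bar>f x\<bar>"
  shows False
proof -
  have "integrable lebesgue (\<lambda>x. c\<^sup>2 * indicator S x)"
  proof (rule Bochner_Integration.integrable_bound[OF f])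
    have "c\<^sup>2 \<le> (f x)\<^sup>2" if "x \<in> S" for x
      using ge[OF that] c abs_le_square_iff[of c "f x"] by simp
    then show "AE x in lebesgue. norm (c\<^sup>2 * indicat_real S x) \<le> norm ((f x)\<^sup>2)"
      by (intro AE_I2) (auto simp: indicator_def)
  qed (use S in auto)
  then have "integrable lebesgue (indicat_real S)"
    using c by simp
  then have fin: "S \<in> fmeasurable lebesgue"
    using S(1) by (auto simp: integrable_indicator_iff fmeasurable_def)
  obtain n :: nat where n: "measure lebesgue S < real n"
    using reals_Archimedean2 by blast
  obtain s where "{s..s + real n} \<subseteq> S" using S(2) by blast
  then have "measure lebesgue {s..s + real n} \<le> measure lebesgue S"
    by (intro measure_mono_fmeasurable fin) auto
  with n show False by simp
qed

text \<open>
  Both tails are translates or reflections of $e^{-kx}$ on $[0,\infty)$.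
\<close>

lemma square_integrable_exp_tails:
  fixes y :: "real \<Rightarrow> real"
  assumes y: "continuous_on UNIV y" and k: "k > 0"
    and right: "\<And>x. b \<le> x \<Longrightarrow> y x = y b * exp (- k * (x - b))"
    and left: "\<And>x. x \<le> a \<Longrightarrow> y x = y a * exp (- k * (a - x))"
  shows "integrable lebesgue (\<lambda>x. (y x)\<^sup>2)"
proof -
  define h where "h x = indicator {0..} x * exp (- (2 * k) * x)" for x :: real
  have h: "integrable lebesgue h"
    using nonnegative_absolutely_integrable_1[OF integrable_on_exp_minus_to_infinity[of "2 * k" 0]] k
    by (simp add: set_integrable_def h_def[abs_def])
  have "integrable lebesgue (\<lambda>x. h (- b + 1 * x))" "integrable lebesgue (\<lambda>x. h (a + (-1) * x))"
    by (rule lebesgue_integrable_real_affine[OF h], simp)+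
  then have h': "integrable lebesgue (\<lambda>x. h (x - b))" "integrable lebesgue (\<lambda>x. h (a - x))"
    by simp_all
  have "(\<lambda>x. (y x)\<^sup>2) absolutely_integrable_on {a..b}"
    by (intro absolutely_integrable_continuous_real continuous_intros continuous_on_subset[OF y]) simp
  then have m: "integrable lebesgue (\<lambda>x. indicator {a..b} x * (y x)\<^sup>2)"
    by (simp add: set_integrable_def)
  show ?thesis
  proof (rule Bochner_Integration.integrable_bound)
    show "integrable lebesgue (\<lambda>x. (y b)\<^sup>2 * h (x - b) + (y a)\<^sup>2 * h (a - x) + indicator {a..b} x * (y x)\<^sup>2)"
      by (intro Bochner_Integration.integrable_add integrable_mult_right h' m)
    have "y \<in> borel_measurable borel" using y by (rule borel_measurable_continuous_onI)
    then show "(\<lambda>x. (y x)\<^sup>2) \<in> borel_measurable lebesgue"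
      by (intro measurable_completion) simp
    have sq: "(exp t)\<^sup>2 = exp (2 * t)" for t :: real
      by (simp add: exp_double)
    have hn: "0 \<le> h t" for t by (simp add: h_def)
    have "(y x)\<^sup>2 \<le> (y b)\<^sup>2 * h (x - b) + (y a)\<^sup>2 * h (a - x) + indicator {a..b} x * (y x)\<^sup>2" for x
    proof -
      have nn: "0 \<le> (y b)\<^sup>2 * h (x - b)" "0 \<le> (y a)\<^sup>2 * h (a - x)" using hn by auto
      consider "b \<le> x" | "x \<le> a" | "x \<in> {a..b}" by fastforce
      then show ?thesis
      proof cases
        case 1
        then have "(y x)\<^sup>2 = (y b)\<^sup>2 * h (x - b)"
          unfolding right[OF 1] by (simp add: h_def power_mult_distrib sq algebra_simps)
        with nn show ?thesis by (simp add: indicator_def)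
      next
        case 2
        then have "(y x)\<^sup>2 = (y a)\<^sup>2 * h (a - x)"
          unfolding left[OF 2] by (simp add: h_def power_mult_distrib sq algebra_simps)
        with nn show ?thesis by (simp add: indicator_def)
      next
        case 3
        with nn show ?thesis by simp
      qed
    qed
    then show "AE x in lebesgue. norm ((y x)\<^sup>2)
        \<le> norm ((y b)\<^sup>2 * h (x - b) + (y a)\<^sup>2 * h (a - x) + indicator {a..b} x * (y x)\<^sup>2)"
      by (intro AE_I2) (use abs_ge_self order_trans in fastforce)
  qed
qed

text \<open>
  Where $W = 0$ the operator factorizes: $y' + k y$ and $y' - k y$ solve first-order equations with
  rates \<open>k\<close> and \<open>-k\<close>. If one of them vanishes at the end point, it vanishes on the half-line, and
  \<open>y\<close> itself solves a first-order equation.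
\<close>

lemma exp_tails_of_zero_potential:
  fixes y p :: "real \<Rightarrow> real"
  assumes y: "has_ac_deriv y p" and p: "has_ac_deriv p (\<lambda>x. (W x + k\<^sup>2) * y x)"
    and W: "AE x in lebesgue. x \<notin> {a..b} \<longrightarrow> W x = 0"
  shows "b \<le> x \<Longrightarrow> p x + k * y x = (p b + k * y b) * exp (k * (x - b))"
    and "x \<le> a \<Longrightarrow> p x - k * y x = (p a - k * y a) * exp (k * (a - x))"
    and "b \<le> x \<Longrightarrow> p b + k * y b = 0 \<Longrightarrow> y x = y b * exp (- k * (x - b))"
    and "x \<le> a \<Longrightarrow> p a - k * y a = 0 \<Longrightarrow> y x = y a * exp (- k * (a - x))"
proof -
  have nb: "AE x in lebesgue. x \<noteq> b" "AE x in lebesgue. x \<noteq> a"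
    by (auto simp: eventually_ae_filter_negligible intro: negligible_sing)
  show R: "p x + k * y x = (p b + k * y b) * exp (k * (x - b))" if "b \<le> x" for x
  proof (rule linear_ac_ode_exp[OF has_ac_deriv_add[OF p has_ac_deriv_cmult[OF y, of k]] _ that])
    show "AE t in lebesgue. t \<in> {b..x} \<longrightarrow> (W t + k\<^sup>2) * y t + k * p t = k * (p t + k * y t)"
      using W nb by eventually_elim (auto simp: algebra_simps power2_eq_square)
  qed
  show L: "p x - k * y x = (p a - k * y a) * exp (k * (a - x))" if "x \<le> a" for x
  proof -
    have "p a - k * y a = (p x - k * y x) * exp (- k * (a - x))"
    proof (rule linear_ac_ode_exp[OF has_ac_deriv_diff[OF p has_ac_deriv_cmult[OF y, of k]] _ that])
      show "AE t in lebesgue. t \<in> {x..a} \<longrightarrow> (W t + k\<^sup>2) * y t - k * p t = - k * (p t - k * y t)"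
        using W nb by eventually_elim (auto simp: algebra_simps power2_eq_square)
    qed
    then show ?thesis
      by (simp only: mult.assoc exp_add[symmetric]) simp
  qed
  show "y x = y b * exp (- k * (x - b))" if "b \<le> x" "p b + k * y b = 0"
  proof (rule linear_ac_ode_exp[OF y _ that(1)])
    show "AE t in lebesgue. t \<in> {b..x} \<longrightarrow> p t = - k * y t"
      using R that(2) by (intro AE_I2) (auto simp: eq_neg_iff_add_eq_0)
  qed
  show "y x = y a * exp (- k * (a - x))" if "x \<le> a" "p a - k * y a = 0"
  proof -
    have "y a = y x * exp (k * (a - x))"
    proof (rule linear_ac_ode_exp[OF y _ that(1)])
      show "AE t in lebesgue. t \<in> {x..a} \<longrightarrow> p t = k * y t"
        using L that(2) by (intro AE_I2) auto
    qed
    then show ?thesis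
      by (simp only: mult.assoc exp_add[symmetric]) simp
  qed
qed

text \<open>
  The combination $y' + k y$ grows like $e^{k(x-b)}$ on the right, and $y' - k y$ grows like
  $e^{k(a-x)}$ on the left; square integrability forces both to vanish.
\<close>

lemma square_integrable_solution:
  fixes y p :: "real \<Rightarrow> real"
  assumes y: "has_ac_deriv y p" and p: "has_ac_deriv p (\<lambda>x. (W x + k\<^sup>2) * y x)"
    and W: "AE x in lebesgue. x \<notin> {a..b} \<longrightarrow> W x = 0"
    and L2: "integrable lebesgue (\<lambda>x. (y x)\<^sup>2)" "integrable lebesgue (\<lambda>x. (p x)\<^sup>2)"
    and k: "k > 0"
  shows "p b = - k * y b" and "p a = k * y a"
proof -
  note tails = exp_tails_of_zero_potential[OF y p W]
  \<comment> \<open>$(p + c y)^2 \le 2 p^2 + 2 c^2 y^2$\<close>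
  have int: "integrable lebesgue (\<lambda>x. (p x + c * y x)\<^sup>2)" for c
  proof (rule Bochner_Integration.integrable_bound)
    show "integrable lebesgue (\<lambda>x. 2 * (p x)\<^sup>2 + (2 * c\<^sup>2) * (y x)\<^sup>2)"
      by (intro Bochner_Integration.integrable_add integrable_mult_right L2)
    have "continuous_on UNIV (\<lambda>x. (p x + c * y x)\<^sup>2)"
      by (intro continuous_intros has_ac_deriv_continuous[OF y] has_ac_deriv_continuous[OF p])
    then have "(\<lambda>x. (p x + c * y x)\<^sup>2) \<in> borel_measurable borel"
      by (rule borel_measurable_continuous_onI)
    then show "(\<lambda>x. (p x + c * y x)\<^sup>2) \<in> borel_measurable lebesgue"
      by (intro measurable_completion) simp
    have "(p x + c * y x)\<^sup>2 \<le> 2 * (p x)\<^sup>2 + (2 * c\<^sup>2) * (y x)\<^sup>2" for x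
      using zero_le_power2[of "p x - c * y x"] by (simp add: power2_eq_square algebra_simps)
    then show "AE x in lebesgue. norm ((p x + c * y x)\<^sup>2) \<le> norm (2 * (p x)\<^sup>2 + (2 * c\<^sup>2) * (y x)\<^sup>2)"
      by (intro AE_I2) (use abs_ge_self order_trans in fastforce)
  qed
  show "p b = - k * y b"
  proof (rule ccontr)
    assume "p b \<noteq> - k * y b"
    then have pos: "0 < \<bar>p b + k * y b\<bar>" by linarith
    show False
    proof (rule square_integrable_not_bounded_below[OF int[of k] pos, of "{b..}"])
      fix x assume "x \<in> {b..}"
      then have "p x + k * y x = (p b + k * y b) * exp (k * (x - b))" "1 \<le> exp (k * (x - b))"
        using tails(1)[of x] k by auto
      then show "\<bar>p b + k * y b\<bar> \<le> \<bar>p x + k * y x\<bar>"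
        using mult_left_mono[of 1 "exp (k * (x - b))" "\<bar>p b + k * y b\<bar>"] by (simp add: abs_mult)
    qed auto
  qed
  show "p a = k * y a"
  proof (rule ccontr)
    assume "p a \<noteq> k * y a"
    then have pos: "0 < \<bar>p a - k * y a\<bar>" by linarith
    show False
    proof (rule square_integrable_not_bounded_below[OF int[of "- k"] pos, of "{..a}"])
      fix x assume "x \<in> {..a}"
      then have "p x - k * y x = (p a - k * y a) * exp (k * (a - x))" "1 \<le> exp (k * (a - x))"
        using tails(2)[of x] k by auto
      then show "\<bar>p a - k * y a\<bar> \<le> \<bar>p x + - k * y x\<bar>"
        using mult_left_mono[of 1 "exp (k * (a - x))" "\<bar>p a - k * y a\<bar>"] by (simp add: abs_mult)
    next
      fix n :: nat show "\<exists>s. {s..s + real n} \<subseteq> {..a}"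
        by (rule exI[of _ "a - real n"]) auto
    qed auto
  qed
qed

text \<open>
  Uniqueness for the initial value problem: on $[a,b]$ by Gronwall, outside by the explicit tails.
  It guarantees that an eigenfunction can be normalized to $y(a) = 1$.
\<close>

lemma solution_vanishes:
  fixes y p :: "real \<Rightarrow> real"
  assumes y: "has_ac_deriv y p" and p: "has_ac_deriv p (\<lambda>x. (W x + k\<^sup>2) * y x)"
    and W: "AE x in lebesgue. x \<notin> {a..b} \<longrightarrow> W x = 0" "AE x in lebesgue. \<bar>W x\<bar> \<le> C" and ab: "a \<le> b"
    and z: "y a = 0" "p a = 0"
  shows "y x = 0"
proof -
  note tails = exp_tails_of_zero_potential[OF y p W(1)]
  have mid: "y x = 0 \<and> p x = 0" if "x \<in> {a..b}" for x
  proof -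
    have C: "0 \<le> \<bar>C\<bar> + k\<^sup>2" by simp
    have "\<bar>y x\<bar> + \<bar>p x\<bar> \<le> (\<bar>y a\<bar> + \<bar>p a\<bar> + 0) * exp ((1 + (\<bar>C\<bar> + k\<^sup>2)) * (x - a))"
    proof (rule gronwall_second_order[OF y p _ _ _ C _ that, of "\<lambda>x. 0"])
      show "AE x in lebesgue. x \<in> {a..b} \<longrightarrow> \<bar>(W x + k\<^sup>2) * y x\<bar> \<le> (\<bar>C\<bar> + k\<^sup>2) * \<bar>y x\<bar> + 0"
        using W(2)
      proof eventually_elim
        case (elim x)
        then have "\<bar>W x + k\<^sup>2\<bar> \<le> \<bar>C\<bar> + k\<^sup>2"
          using abs_triangle_ineq[of "W x" "k\<^sup>2"] by simp
        then show ?case by (simp add: abs_mult mult_right_mono)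
      qed
    qed (auto intro: locally_integrable_continuous)
    then show ?thesis using z abs_ge_zero[of "y x"] abs_ge_zero[of "p x"] by simp
  qed
  consider "b \<le> x" | "x \<le> a" | "x \<in> {a..b}" by fastforce
  then show ?thesis
    by cases (use mid[of b] ab z tails(3,4)[of x] mid[of x] in auto)
qed

text \<open>
  The potential and the energy are real, so the real and the imaginary part of an eigenfunction are
  solutions too, and one of them is nonzero.
\<close>

lemma eigenvalue_imp_jost_root:
  assumes eig: "schrodinger_eigenvalue W (of_real (- k\<^sup>2))" and k: "k > 0"
    and W: "AE x in lebesgue. x \<notin> {a..b} \<longrightarrow> W x = 0" "AE x in lebesgue. \<bar>W x\<bar> \<le> C" and ab: "a \<le> b"
  shows "\<exists>y p. jost_solution W a k y p \<and> p b + k * y b = 0"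
proof -
  obtain f where f: "\<not> (AE x in lebesgue. f x = 0)"
    "schrodinger_op_graph W f (\<lambda>x. of_real (- k\<^sup>2) * f x)"
    using eig unfolding schrodinger_eigenvalue_def by blast
  from f(2) obtain f1 f2 where f12: "has_ac_deriv f f1" "has_ac_deriv f1 f2"
    "AE x in lebesgue. of_real (- k\<^sup>2) * f x = - f2 x + of_real (W x) * f x"
    and sob: "f \<in> sobolev_W22"
    unfolding schrodinger_op_graph_def by blast
  from sob obtain g1 g2 where g: "in_L2 f" "has_ac_deriv f g1" "has_ac_deriv g1 g2" "in_L2 g1"
    unfolding sobolev_W22_def by blast
  have main: "\<exists>y p. jost_solution W a k y p \<and> p b + k * y b = 0"
    if c: "bounded_linear c" "\<And>z. \<bar>c z\<bar> \<le> norm z" "\<And>r z. c (of_real r * z) = r * c z"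
      and nz: "\<exists>x. c (f x) \<noteq> 0" for c :: "complex \<Rightarrow> real"
  proof -
    interpret c: bounded_linear c by fact
    have y: "has_ac_deriv (\<lambda>x. c (f x)) (\<lambda>x. c (f1 x))"
      and p0: "has_ac_deriv (\<lambda>x. c (f1 x)) (\<lambda>x. c (f2 x))"
      and y': "has_ac_deriv (\<lambda>x. c (f x)) (\<lambda>x. c (g1 x))"
      and p': "has_ac_deriv (\<lambda>x. c (g1 x)) (\<lambda>x. c (g2 x))"
      using f12 g c(1) by (blast intro: has_ac_deriv_bounded_linear)+
    \<comment> \<open>the derivatives supplied by the operator graph and by the Sobolev space agree by continuity\<close>
    have eq: "c (f1 x) = c (g1 x)" for x
      using has_ac_deriv_has_real_derivative[OF y has_ac_deriv_continuous[OF p0], of x]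
        has_ac_deriv_has_real_derivative[OF y' has_ac_deriv_continuous[OF p'], of x]
      by (rule DERIV_unique)
    have p: "has_ac_deriv (\<lambda>x. c (f1 x)) (\<lambda>x. (W x + k\<^sup>2) * c (f x))"
    proof (rule has_ac_deriv_cong_AE[OF p0])
      show "AE x in lebesgue. c (f2 x) = (W x + k\<^sup>2) * c (f x)"
        using f12(3)
      proof eventually_elim
        case (elim x)
        then have "f2 x = of_real (W x + k\<^sup>2) * f x" by (simp add: algebra_simps)
        then show ?case by (simp only: c(3))
      qed
    qed
    have L2c: "integrable lebesgue (\<lambda>x. (c (h x))\<^sup>2)" if "in_L2 h" for h
    proof (rule Bochner_Integration.integrable_bound)
      show "integrable lebesgue (\<lambda>x. (norm (h x))\<^sup>2)" using that by (simp add: in_L2_def)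
      have "h \<in> borel_measurable lebesgue" using that by (simp add: in_L2_def)
      then show "(\<lambda>x. (c (h x))\<^sup>2) \<in> borel_measurable lebesgue"
        using borel_measurable_continuous_onI[OF c.continuous_on[OF continuous_on_id]]
        by (intro borel_measurable_power) (rule measurable_compose)
      show "AE x in lebesgue. norm ((c (h x))\<^sup>2) \<le> norm ((norm (h x))\<^sup>2)"
        using c(2) by (intro AE_I2) (simp add: abs_le_square_iff[symmetric])
    qed
    have L2: "integrable lebesgue (\<lambda>x. (c (f x))\<^sup>2)" "integrable lebesgue (\<lambda>x. (c (f1 x))\<^sup>2)"
      using L2c[OF g(1)] L2c[OF g(4)] by (simp_all add: eq)
    note bc = square_integrable_solution[OF y p W(1) L2 k]
    have "c (f a) \<noteq> 0"
      using solution_vanishes[OF y p W ab] bc(2) nz by fastforce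
    then show ?thesis
      using has_ac_deriv_cmult[OF y, of "1 / c (f a)"] has_ac_deriv_cmult[OF p, of "1 / c (f a)"] bc
      by (intro exI[of _ "\<lambda>x. 1 / c (f a) * c (f x)"] exI[of _ "\<lambda>x. 1 / c (f a) * c (f1 x)"])
        (simp add: jost_solution_def field_simps)
  qed
  have "\<exists>x. f x \<noteq> 0" using f(1) by auto
  then have "(\<exists>x. Re (f x) \<noteq> 0) \<or> (\<exists>x. Im (f x) \<noteq> 0)"
    by (auto simp: complex_eq_iff)
  then show ?thesis
  proof
    assume "\<exists>x. Re (f x) \<noteq> 0"
    then show ?thesis by (rule main[OF bounded_linear_Re abs_Re_le_cmod, rotated]) simp
  next
    assume "\<exists>x. Im (f x) \<noteq> 0"
    then show ?thesis by (rule main[OF bounded_linear_Im abs_Im_le_cmod, rotated]) simp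
  qed
qed

lemma jost_root_imp_eigenvalue:
  fixes y p :: "real \<Rightarrow> real"
  assumes jost: "jost_solution W a k y p" "p b + k * y b = 0"
    and Wm: "W \<in> borel_measurable lebesgue"
    and W: "AE x in lebesgue. x \<notin> {a..b} \<longrightarrow> W x = 0" "AE x in lebesgue. \<bar>W x\<bar> \<le> C"
    and k: "k > 0"
  shows "schrodinger_eigenvalue W (of_real (- k\<^sup>2))"
proof -
  have y: "has_ac_deriv y p" and p: "has_ac_deriv p (\<lambda>x. (W x + k\<^sup>2) * y x)"
    and bc: "y a = 1" "p a = k" "p b + k * y b = 0"
    using jost by (auto simp: jost_solution_def)
  note tails = exp_tails_of_zero_potential[OF y p W(1)]
  have cy: "continuous_on UNIV y" and cp: "continuous_on UNIV p"
    using y p has_ac_deriv_continuous by blast+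
  have yb: "y x = y b * exp (- k * (x - b))" if "b \<le> x" for x by (rule tails(3)[OF that bc(3)])
  have ya: "y x = y a * exp (- k * (a - x))" if "x \<le> a" for x by (rule tails(4)[OF that]) (simp add: bc)
  have pb: "p x = p b * exp (- k * (x - b))" if "b \<le> x" for x
  proof -
    have "p x = - k * y x" "p b = - k * y b"
      using tails(1)[OF that] bc by (auto simp: eq_neg_iff_add_eq_0)
    then show ?thesis using yb[OF that] by simp
  qed
  have pa: "p x = p a * exp (- k * (a - x))" if "x \<le> a" for x
  proof -
    have "p x = k * y x" using tails(2)[OF that] bc by simp
    then show ?thesis using ya[OF that] bc by simp
  qed
  have Iy: "integrable lebesgue (\<lambda>x. (y x)\<^sup>2)"
    using cy k yb ya by (rule square_integrable_exp_tails)
  have Ip: "integrable lebesgue (\<lambda>x. (p x)\<^sup>2)"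
    using cp k pb pa by (rule square_integrable_exp_tails)
  have my: "y \<in> borel_measurable lebesgue" and mp: "p \<in> borel_measurable lebesgue"
    using cy cp by (auto intro!: measurable_completion borel_measurable_continuous_onI)
  have mq: "(\<lambda>x. (W x + k\<^sup>2) * y x) \<in> borel_measurable lebesgue"
    using Wm my by measurable
  have Iq: "integrable lebesgue (\<lambda>x. ((W x + k\<^sup>2) * y x)\<^sup>2)"
  proof (rule Bochner_Integration.integrable_bound)
    show "integrable lebesgue (\<lambda>x. (\<bar>C\<bar> + k\<^sup>2)\<^sup>2 * (y x)\<^sup>2)"
      by (intro integrable_mult_right Iy)
    show "(\<lambda>x. ((W x + k\<^sup>2) * y x)\<^sup>2) \<in> borel_measurable lebesgue"
      using mq by measurable
    show "AE x in lebesgue. norm (((W x + k\<^sup>2) * y x)\<^sup>2) \<le> norm ((\<bar>C\<bar> + k\<^sup>2)\<^sup>2 * (y x)\<^sup>2)"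
      using W(2)
    proof eventually_elim
      case (elim x)
      then have "\<bar>W x + k\<^sup>2\<bar> \<le> \<bar>\<bar>C\<bar> + k\<^sup>2\<bar>"
        using abs_triangle_ineq[of "W x" "k\<^sup>2"] by simp
      then have "(W x + k\<^sup>2)\<^sup>2 \<le> (\<bar>C\<bar> + k\<^sup>2)\<^sup>2"
        by (simp only: abs_le_square_iff)
      then show ?case
        by (simp add: power_mult_distrib mult_right_mono)
    qed
  qed
  have L2: "in_L2 (\<lambda>x. complex_of_real (h x))"
    if "h \<in> borel_measurable lebesgue" "integrable lebesgue (\<lambda>x. (h x)\<^sup>2)" for h
    using that by (simp add: in_L2_def)
  let ?f = "\<lambda>x. complex_of_real (y x)" and ?f1 = "\<lambda>x. complex_of_real (p x)"
    and ?f2 = "\<lambda>x. complex_of_real ((W x + k\<^sup>2) * y x)"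
  have ac: "has_ac_deriv ?f ?f1" "has_ac_deriv ?f1 ?f2"
    by (rule has_ac_deriv_bounded_linear[OF bounded_linear_of_real y])
      (rule has_ac_deriv_bounded_linear[OF bounded_linear_of_real p])
  have "?f \<in> sobolev_W22"
    unfolding sobolev_W22_def using ac L2[OF my Iy] L2[OF mp Ip] L2[OF mq Iq] by blast
  moreover have "in_L2 (\<lambda>x. of_real (- k\<^sup>2) * ?f x)"
    using L2[of "\<lambda>x. - k\<^sup>2 * y x"] my Iy by (simp add: power_mult_distrib)
  ultimately have "schrodinger_op_graph W ?f (\<lambda>x. of_real (- k\<^sup>2) * ?f x)"
    unfolding schrodinger_op_graph_def
    by (intro conjI exI[of _ ?f1] exI[of _ ?f2] ac) (auto simp: algebra_simps)
  moreover have "\<not> (AE x in lebesgue. ?f x = 0)"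
  proof
    assume "AE x in lebesgue. ?f x = 0"
    then have "AE x in lebesgue. x \<in> {a - 1..a} \<longrightarrow> False"
    proof eventually_elim
      case (elim x)
      then show ?case using ya[of x] bc by auto
    qed
    then obtain N where "negligible N" "{x. \<not> (x \<in> {a - 1..a} \<longrightarrow> False)} \<subseteq> N"
      unfolding eventually_ae_filter_negligible by blast
    then have "negligible N" "{a - 1..a} \<subseteq> N" by auto
    then have "negligible {a - 1..a}" by (rule negligible_subset)
    then show False
      using negligible_interval(1)[of "a - 1" a] by simp
  qed
  ultimately show ?thesis
    unfolding schrodinger_eigenvalue_def by (intro exI[of _ ?f] conjI)
qed

section \<open>Dependence of Jost solutions on the wave number\<close>

lemma locally_integrable_bounded:
  fixes f :: "real \<Rightarrow> real"
  assumes "f \<in> borel_measurable lebesgue" "AE x in lebesgue. \<bar>f x\<bar> \<le> C"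
  shows "locally_integrable f"
  using assms
  by (intro locally_integrable_measurable_bound[OF locally_integrable_continuous[of "\<lambda>x. C"]]) auto

lemma continuous_on_Icc_bound:
  fixes f :: "real \<Rightarrow> real"
  assumes "continuous_on UNIV f" "a \<le> b"
  obtains x where "x \<in> {a..b}" "\<And>t. t \<in> {a..b} \<Longrightarrow> \<bar>f t\<bar> \<le> \<bar>f x\<bar>"
proof -
  have "continuous_on {a..b} (\<lambda>x. \<bar>f x\<bar>)"
    by (intro continuous_intros continuous_on_subset[OF assms(1)]) simp
  then show ?thesis
    using continuous_attains_sup[of "{a..b}" "\<lambda>x. \<bar>f x\<bar>"] assms(2) that by auto
qed

lemma jost_solution_bound:
  assumes y: "jost_solution W a k y p" and W: "AE x in lebesgue. \<bar>W x\<bar> \<le> C"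
    and k: "\<bar>k\<bar> \<le> R" and x: "x \<in> {a..b}"
  shows "\<bar>y x\<bar> + \<bar>p x\<bar> \<le> (1 + R) * exp ((1 + (\<bar>C\<bar> + R\<^sup>2)) * (b - a))"
proof -
  have kR: "k\<^sup>2 \<le> R\<^sup>2" using k abs_le_square_iff[of k R] by simp
  have "\<bar>y x\<bar> + \<bar>p x\<bar> \<le> (\<bar>y a\<bar> + \<bar>p a\<bar> + 0) * exp ((1 + (\<bar>C\<bar> + R\<^sup>2)) * (x - a))"
  proof (rule gronwall_second_order[where q = "\<lambda>x. (W x + k\<^sup>2) * y x" and h = "\<lambda>x. 0" and b = b])
    show "AE x in lebesgue. x \<in> {a..b} \<longrightarrow> \<bar>(W x + k\<^sup>2) * y x\<bar> \<le> (\<bar>C\<bar> + R\<^sup>2) * \<bar>y x\<bar> + 0"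
      using W
    proof eventually_elim
      case (elim x)
      then have "\<bar>W x + k\<^sup>2\<bar> \<le> \<bar>C\<bar> + R\<^sup>2"
        using abs_triangle_ineq[of "W x" "k\<^sup>2"] kR by simp
      then show ?case by (simp add: abs_mult mult_right_mono)
    qed
  qed (use y x in \<open>auto simp: jost_solution_def intro: locally_integrable_continuous\<close>)
  also have "\<dots> \<le> (1 + R) * exp ((1 + (\<bar>C\<bar> + R\<^sup>2)) * (b - a))"
    using x y k by (intro mult_mono) (auto simp: jost_solution_def intro!: mult_left_mono)
  finally show ?thesis .
qed

text \<open>
  The difference of two Jost solutions solves the equation with source $(k_1^2 - k_2^2) y_1$, and
  its data at \<open>a\<close> differ by $k_1 - k_2$.
\<close>

lemma jost_solution_lipschitz:
  assumes y1: "jost_solution W a k1 y1 p1" and y2: "jost_solution W a k2 y2 p2"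
    and W: "AE x in lebesgue. \<bar>W x\<bar> \<le> C" and k: "\<bar>k1\<bar> \<le> R" "\<bar>k2\<bar> \<le> R" and ab: "a \<le> b"
  defines "E \<equiv> exp ((1 + (\<bar>C\<bar> + R\<^sup>2)) * (b - a))"
  shows "\<bar>y1 b - y2 b\<bar> + \<bar>p1 b - p2 b\<bar> \<le> \<bar>k1 - k2\<bar> * ((1 + 2 * R * (b - a) * ((1 + R) * E)) * E)"
proof -
  have kR: "k2\<^sup>2 \<le> R\<^sup>2" using k abs_le_square_iff[of k2 R] by simp
  have R: "0 \<le> R" using k by linarith
  define Y where "Y = (1 + R) * E"
  have Y0: "0 \<le> Y" using R by (simp add: Y_def E_def)
  have Y: "\<bar>y1 x\<bar> \<le> Y" if "x \<in> {a..b}" for x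
    using jost_solution_bound[OF y1 W k(1) that] unfolding Y_def E_def by linarith
  define c where "c = \<bar>k1\<^sup>2 - k2\<^sup>2\<bar> * Y"
  have c0: "0 \<le> c" using Y0 by (simp add: c_def)
  have "\<bar>y1 b - y2 b\<bar> + \<bar>p1 b - p2 b\<bar>
      \<le> (\<bar>y1 a - y2 a\<bar> + \<bar>p1 a - p2 a\<bar> + c * (b - a)) * exp ((1 + (\<bar>C\<bar> + R\<^sup>2)) * (b - a))"
  proof (rule gronwall_second_order[where h = "\<lambda>x. c" and b = b])
    show "has_ac_deriv (\<lambda>x. y1 x - y2 x) (\<lambda>x. p1 x - p2 x)"
      "has_ac_deriv (\<lambda>x. p1 x - p2 x) (\<lambda>x. (W x + k1\<^sup>2) * y1 x - (W x + k2\<^sup>2) * y2 x)"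
      using y1 y2 by (auto simp: jost_solution_def intro!: has_ac_deriv_diff)
    show "AE x in lebesgue. x \<in> {a..b} \<longrightarrow>
        \<bar>(W x + k1\<^sup>2) * y1 x - (W x + k2\<^sup>2) * y2 x\<bar> \<le> (\<bar>C\<bar> + R\<^sup>2) * \<bar>y1 x - y2 x\<bar> + c"
      using W
    proof eventually_elim
      case (elim x)
      show ?case
      proof
        assume x: "x \<in> {a..b}"
        have "\<bar>W x + k2\<^sup>2\<bar> \<le> \<bar>C\<bar> + R\<^sup>2"
          using abs_triangle_ineq[of "W x" "k2\<^sup>2"] kR elim by simp
        then have "\<bar>(W x + k2\<^sup>2) * (y1 x - y2 x)\<bar> \<le> (\<bar>C\<bar> + R\<^sup>2) * \<bar>y1 x - y2 x\<bar>"
          by (simp add: abs_mult mult_right_mono)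
        moreover have "\<bar>(k1\<^sup>2 - k2\<^sup>2) * y1 x\<bar> \<le> c"
          using Y[OF x] by (simp add: abs_mult c_def mult_left_mono)
        moreover have "(W x + k1\<^sup>2) * y1 x - (W x + k2\<^sup>2) * y2 x
            = (W x + k2\<^sup>2) * (y1 x - y2 x) + (k1\<^sup>2 - k2\<^sup>2) * y1 x"
          by (simp add: algebra_simps)
        ultimately show "\<bar>(W x + k1\<^sup>2) * y1 x - (W x + k2\<^sup>2) * y2 x\<bar>
            \<le> (\<bar>C\<bar> + R\<^sup>2) * \<bar>y1 x - y2 x\<bar> + c" by linarith
      qed
    qed
  qed (use ab c0 in \<open>auto intro: locally_integrable_continuous\<close>)
  also have "\<dots> = (\<bar>k1 - k2\<bar> + c * (b - a)) * E"
    using y1 y2 by (simp add: jost_solution_def E_def)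
  also have "c \<le> \<bar>k1 - k2\<bar> * (2 * R * Y)"
  proof -
    have "\<bar>k1\<^sup>2 - k2\<^sup>2\<bar> = \<bar>k1 - k2\<bar> * \<bar>k1 + k2\<bar>"
      by (simp add: abs_mult[symmetric] power2_eq_square algebra_simps)
    also have "\<dots> \<le> \<bar>k1 - k2\<bar> * (2 * R)" using k by (intro mult_left_mono) auto
    finally show ?thesis
      unfolding c_def mult.assoc[symmetric] by (rule mult_right_mono[OF _ Y0, unfolded mult.assoc[symmetric]])
  qed
  then have "(\<bar>k1 - k2\<bar> + c * (b - a)) * E \<le> (\<bar>k1 - k2\<bar> + \<bar>k1 - k2\<bar> * (2 * R * Y) * (b - a)) * E"
    using ab by (intro mult_right_mono add_left_mono) (auto simp: E_def)
  also have "\<dots> = \<bar>k1 - k2\<bar> * ((1 + 2 * R * (b - a) * Y) * E)"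
    by (simp add: algebra_simps)
  finally show ?thesis by (simp add: Y_def)
qed

text \<open>
  The intermediate value theorem for \<open>s\<close> times the Jost function. In the application $s = \<theta>$
  is the factor with which the Jost function appears in the Wronskian identity; the strict
  inequality at $k_1$ makes it nonzero.
\<close>

lemma jost_function_root:
  assumes Wm: "W \<in> borel_measurable lebesgue" and W: "AE x in lebesgue. \<bar>W x\<bar> \<le> C"
    and W0: "AE x in lebesgue. x < a \<longrightarrow> W x = 0" and ab: "a \<le> b" and k: "0 < k1" "k1 \<le> k2"
    and low: "\<And>y p. jost_solution W a k1 y p \<Longrightarrow> s * (p b + k1 * y b) < 0"
    and high: "\<And>y p. jost_solution W a k2 y p \<Longrightarrow> s * (p b + k2 * y b) \<ge> 0"
  shows "\<exists>k y p. k1 \<le> k \<and> k \<le> k2 \<and> jost_solution W a k y p \<and> p b + k * y b = 0"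
proof -
  have "\<forall>k. \<exists>z. jost_solution W a k (fst z) (snd z)"
    using jost_solution_exists[OF Wm W W0] by simp
  then obtain Z where Z: "\<And>k. jost_solution W a k (fst (Z k)) (snd (Z k))" by metis
  define y p where "y k = fst (Z k)" and "p k = snd (Z k)" for k
  have J: "jost_solution W a k (y k) (p k)" for k using Z by (simp add: y_def p_def)
  define \<Phi> where "\<Phi> k = s * (p k b + k * y k b)" for k
  define E where "E = exp ((1 + (\<bar>C\<bar> + k2\<^sup>2)) * (b - a))"
  define K where "K = (1 + 2 * k2 * (b - a) * ((1 + k2) * E)) * E"
  have lip: "\<bar>y k b - y k' b\<bar> + \<bar>p k b - p k' b\<bar> \<le> \<bar>k - k'\<bar> * K"
    if "k \<in> {k1..k2}" "k' \<in> {k1..k2}" for k k'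
    unfolding K_def E_def by (rule jost_solution_lipschitz[OF J J W _ _ ab]) (use that k in auto)
  have K0: "0 \<le> K" unfolding K_def E_def using ab k by simp
  have "K-lipschitz_on {k1..k2} (\<lambda>k. y k b)" "K-lipschitz_on {k1..k2} (\<lambda>k. p k b)"
    using lip K0 by (auto intro!: lipschitz_onI simp: dist_real_def mult.commute[of K]) (smt (verit) lip atLeastAtMost_iff)+
  then have "continuous_on {k1..k2} (\<lambda>k. y k b)" "continuous_on {k1..k2} (\<lambda>k. p k b)"
    by (auto intro: lipschitz_on_continuous_on)
  then have "continuous_on {k1..k2} \<Phi>"
    unfolding \<Phi>_def by (intro continuous_intros)
  moreover have "\<Phi> k1 \<le> 0" "0 \<le> \<Phi> k2"
    using low[OF J] high[OF J] by (auto simp: \<Phi>_def less_imp_le)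
  ultimately obtain r where "k1 \<le> r" "r \<le> k2" "\<Phi> r = 0"
    using IVT'[of \<Phi> k1 0 k2] k by auto
  moreover have "s \<noteq> 0" using low[OF J] by auto
  ultimately show ?thesis using J[of r] by (auto simp: \<Phi>_def)
qed

section \<open>Low-energy expansion of the Jost function\<close>

text \<open>
  The boundary data of \<open>u\<close> and \<open>v\<close> express that \<open>u\<close> is a normalized half-bound state with right
  limit \<open>\<theta>\<close>, and that \<open>v\<close> vanishes on the left of the supports.
\<close>

locale zero_energy_resonance =
  fixes U V V\<^sub>1 u u' v v' :: "real \<Rightarrow> real" and a b C \<theta> :: real
  assumes ab: "a \<le> b"
    and meas: "U \<in> borel_measurable lebesgue" "V \<in> borel_measurable lebesgue"
      "V\<^sub>1 \<in> borel_measurable lebesgue"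
    and bounds: "AE x in lebesgue. \<bar>U x\<bar> \<le> C" "AE x in lebesgue. \<bar>V x\<bar> \<le> C"
      "AE x in lebesgue. \<bar>V\<^sub>1 x\<bar> \<le> C"
    and u: "has_ac_deriv u u'" "has_ac_deriv u' (\<lambda>x. U x * u x)"
    and u_bc: "u a = 1" "u' a = 0" "u b = \<theta>" "u' b = 0"
    and v: "has_ac_deriv v v'" "has_ac_deriv v' (\<lambda>x. U x * v x + V x * u x)"
    and v_bc: "v a = 0" "v' a = 0"
    and orthogonal: "integral {a..b} (\<lambda>x. V x * (u x)\<^sup>2) = 0"
begin

definition B where "B = integral {a..b} (\<lambda>x. V x * v x * u x + V\<^sub>1 x * (u x)\<^sup>2)"

lemma C_nonneg: "0 \<le> C"
proof (rule ccontr)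
  assume "\<not> 0 \<le> C"
  then have "AE x in lebesgue :: real measure. False"
    using bounds(1) by (auto elim: eventually_mono)
  then obtain N :: "real set" where "negligible N" "{x. \<not> False} \<subseteq> N"
    unfolding eventually_ae_filter_negligible by blast
  then have "N = UNIV" by auto
  with \<open>negligible N\<close> show False by simp
qed

lemma locally_integrable_UV: "locally_integrable U" "locally_integrable V" "locally_integrable V\<^sub>1"
  by (rule locally_integrable_bounded; fact meas bounds)+

text \<open>
  The exact perturbation is $\<lambda> (V + \<lambda> V_1 + D)$ with \<open>l\<close> in the role of \<open>\<lambda>\<close>. Two rounds of
  Gronwall compare \<open>y\<close> first with \<open>u\<close> and then with $u + l v$; the remainder of the Wronskian identity
  is
  \[ k \<theta> (y(b) - u(b)) + \int_a^b \bigl( l V (y - u - l v) u + l^2 V_1 (y - u) u + l D y u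
     + k^2 y u \bigr), \]
  after the terms $l \int V u^2 = 0$ and $l^2 B$ have been split off. The quotient $D/l$ is only
  known to be small in the mean, so \<open>D\<close> enters through $\int |D|$. The first round bounds the
  supremum of \<open>|y|\<close> in terms of itself, and the smallness of $l + k$ absorbs it.
\<close>

lemma jost_function_estimate:
  "\<exists>A>0. \<exists>\<delta>>0. \<forall>l k D y p. 0 < l \<longrightarrow> l \<le> \<delta> \<longrightarrow> 0 < k \<longrightarrow> k \<le> \<delta> \<longrightarrow> locally_integrable D \<longrightarrow>
     integral {a..b} (\<lambda>x. \<bar>D x\<bar>) \<le> l \<longrightarrow>
     jost_solution (\<lambda>x. U x + l * (V x + l * V\<^sub>1 x + D x)) a k y p \<longrightarrow>
     \<bar>\<theta> * (p b + k * y b) - (k * (1 + \<theta>\<^sup>2) + l\<^sup>2 * B)\<bar>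
       \<le> A * (k * (l + k) + l ^ 3 + l * integral {a..b} (\<lambda>x. \<bar>D x\<bar>))"
proof -
  have cu: "continuous_on UNIV u" and cv: "continuous_on UNIV v"
    using u v has_ac_deriv_continuous by blast+
  obtain M where M: "0 \<le> M" "\<And>x. x \<in> {a..b} \<Longrightarrow> \<bar>u x\<bar> \<le> M"
    using continuous_on_Icc_bound[OF cu ab] abs_ge_zero by metis
  define d where "d = b - a"
  have d0: "0 \<le> d" using ab by (simp add: d_def)
  note C0 = C_nonneg
  define E where "E = exp ((1 + C) * d)"
  have E1: "1 \<le> E" unfolding E_def using C0 d0 by simp
  \<comment> \<open>the constants of the proof: $|y| \<le> Y_0$, $|y - u| \<le> Z_0 (l + k)$,
    $|y - u - l v| \<le> W_0 (k + l^2)$, and \<open>A1\<close> belongs to the remainder integral\<close>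
  define A0 where "A0 = 2 * C * d + 1 + d"
  have A00: "1 \<le> A0" unfolding A0_def using C0 d0 by simp
  define Y0 where "Y0 = 2 * (M + E)"
  have Y00: "0 \<le> Y0" unfolding Y0_def using M E1 by simp
  define Z0 where "Z0 = E * (1 + Y0 * A0)"
  have Z00: "0 \<le> Z0" unfolding Z0_def using E1 Y00 A00 by simp
  define W1 where "W1 = C * Z0 * d + C * Y0 * d + Y0 + Y0 * d"
  have W10: "0 \<le> W1" unfolding W1_def using C0 Z00 Y00 d0 by simp
  define W0 where "W0 = E * (1 + W1)"
  have W00: "0 \<le> W0" unfolding W0_def using E1 W10 by simp
  define A1 where "A1 = C * W0 * M * d + C * Z0 * M * d + Y0 * M + Y0 * M * d"
  have A10: "0 \<le> A1" unfolding A1_def using C0 Z00 W00 Y00 d0 M by simp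
  define A where "A = \<bar>\<theta>\<bar> * Z0 + A1 + 1"
  have A_pos: "0 < A" unfolding A_def using A10 Z00 by (simp add: add_nonneg_pos)
  define \<delta> where "\<delta> = min 1 (1 / (4 * E * A0))"
  have \<delta>: "0 < \<delta>" unfolding \<delta>_def using E1 A00 by simp
  have main: "\<bar>\<theta> * (p b + k * y b) - (k * (1 + \<theta>\<^sup>2) + l\<^sup>2 * B)\<bar>
      \<le> A * (k * (l + k) + l ^ 3 + l * integral {a..b} (\<lambda>x. \<bar>D x\<bar>))"
    if l: "0 < l" "l \<le> \<delta>" and k: "0 < k" "k \<le> \<delta>" and D: "locally_integrable D"
      and \<rho>l: "integral {a..b} (\<lambda>x. \<bar>D x\<bar>) \<le> l"
      and y: "jost_solution (\<lambda>x. U x + l * (V x + l * V\<^sub>1 x + D x)) a k y p"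
    for l k D y p
  proof -
    define \<rho> where "\<rho> = integral {a..b} (\<lambda>x. \<bar>D x\<bar>)"
    have \<rho>: "0 \<le> \<rho>" "\<rho> \<le> l"
      unfolding \<rho>_def using \<rho>l by (auto intro!: integral_nonneg locally_integrable_integrable_on locally_integrable_abs D)
    have l1: "l \<le> 1" and k1: "k \<le> 1" using l k by (auto simp: \<delta>_def)
    have sq: "k\<^sup>2 \<le> k" "l\<^sup>2 \<le> l" "l * k \<le> k"
      using l l1 k k1 by (auto simp: power2_eq_square mult_left_le mult_left_le_one_le)
    have small: "E * A0 * (l + k) \<le> 1 / 2"
    proof -
      have "l \<le> 1 / (4 * E * A0)" "k \<le> 1 / (4 * E * A0)" using l k by (auto simp: \<delta>_def)
      then have "l + k \<le> 2 * (1 / (4 * E * A0))" by linarith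
      then have "E * A0 * (l + k) \<le> E * A0 * (2 * (1 / (4 * E * A0)))"
        using E1 A00 by (intro mult_left_mono) auto
      also have "\<dots> = 1 / 2" using E1 A00 by (simp add: field_simps)
      finally show ?thesis .
    qed
    have int_aff: "integral {a..b} (\<lambda>x. \<alpha> + \<beta> * \<bar>D x\<bar>) = \<alpha> * d + \<beta> * \<rho>" for \<alpha> \<beta>
      using ab integral_add[of "\<lambda>x. \<alpha>" "{a..b}" "\<lambda>x. \<beta> * \<bar>D x\<bar>"]
        integrable_const_ivl[of \<alpha> a b]
        integrable_on_mult_right[OF
          locally_integrable_integrable_on[OF locally_integrable_abs[OF D]], of \<beta> a b]
      by (simp add: \<rho>_def d_def mult.commute)
    have loc_aff: "locally_integrable (\<lambda>x. \<alpha> + \<beta> * \<bar>D x\<bar>)" for \<alpha> \<beta>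
    proof (rule locally_integrable_add)
      show "locally_integrable (\<lambda>x. \<alpha>)" by (rule locally_integrable_continuous) simp
      show "locally_integrable (\<lambda>x. \<beta> * \<bar>D x\<bar>)"
        by (rule locally_integrable_bounded_linear[OF bounded_linear_mult_right locally_integrable_abs[OF D]])
    qed
    \<comment> \<open>Gronwall with the fixed potential \<open>U\<close> and a source bounded by $\<alpha> + \<beta> |D|$\<close>
    have gron: "\<bar>z x\<bar> \<le> E * (k + (\<alpha> * d + \<beta> * \<rho>))"
      if z: "has_ac_deriv z z'" "has_ac_deriv z' z''" "z a = 0" "z' a = k" and nn: "0 \<le> \<alpha>" "0 \<le> \<beta>"
        and ae: "AE x in lebesgue. x \<in> {a..b} \<longrightarrow> \<bar>z'' x - U x * z x\<bar> \<le> \<alpha> + \<beta> * \<bar>D x\<bar>"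
        and x: "x \<in> {a..b}" for z z' z'' \<alpha> \<beta> x
    proof -
      have "\<bar>z x\<bar> + \<bar>z' x\<bar> \<le> (\<bar>z a\<bar> + \<bar>z' a\<bar> + (\<alpha> * d + \<beta> * \<rho>)) * exp ((1 + C) * (x - a))"
      proof (rule gronwall_second_order[OF z(1,2) loc_aff _ _ C0 _ x])
        show "AE x in lebesgue. x \<in> {a..b} \<longrightarrow> \<bar>z'' x\<bar> \<le> C * \<bar>z x\<bar> + (\<alpha> + \<beta> * \<bar>D x\<bar>)"
          using ae bounds(1)
        proof eventually_elim
          case (elim x)
          show ?case
          proof
            assume "x \<in> {a..b}"
            with elim have "\<bar>z'' x - U x * z x\<bar> \<le> \<alpha> + \<beta> * \<bar>D x\<bar>" by blast
            moreover have "\<bar>U x * z x\<bar> \<le> C * \<bar>z x\<bar>"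
              using elim(2) by (simp add: abs_mult mult_right_mono)
            ultimately show "\<bar>z'' x\<bar> \<le> C * \<bar>z x\<bar> + (\<alpha> + \<beta> * \<bar>D x\<bar>)" by linarith
          qed
        qed
      qed (use nn int_aff in auto)
      also have "\<dots> = (k + (\<alpha> * d + \<beta> * \<rho>)) * exp ((1 + C) * (x - a))"
        using z k by simp
      also have "\<dots> \<le> (k + (\<alpha> * d + \<beta> * \<rho>)) * E"
        unfolding E_def d_def using x C0 k nn \<rho> ab by (intro mult_left_mono) (auto intro!: mult_left_mono)
      finally show ?thesis by (simp add: mult.commute)
    qed
    have yp: "has_ac_deriv y p" "y a = 1" "p a = k"
      "has_ac_deriv p (\<lambda>x. (U x + l * (V x + l * V\<^sub>1 x + D x) + k\<^sup>2) * y x)"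
      using y by (auto simp: jost_solution_def)
    have cy: "continuous_on UNIV y" using yp(1) by (rule has_ac_deriv_continuous)
    obtain x0 where x0: "x0 \<in> {a..b}" "\<And>t. t \<in> {a..b} \<Longrightarrow> \<bar>y t\<bar> \<le> \<bar>y x0\<bar>"
      using continuous_on_Icc_bound[OF cy ab] by blast
    define Y where "Y = \<bar>y x0\<bar>"
    have Y: "0 \<le> Y" "\<And>x. x \<in> {a..b} \<Longrightarrow> \<bar>y x\<bar> \<le> Y" using x0 by (auto simp: Y_def)
    have zY: "\<bar>y x - u x\<bar> \<le> E * (k + Y * A0 * (l + k))" if x: "x \<in> {a..b}" for x
    proof -
      have "\<bar>y x - u x\<bar> \<le> E * (k + ((l * C + l\<^sup>2 * C + k\<^sup>2) * Y * d + l * Y * \<rho>))"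
      proof (rule gron[OF has_ac_deriv_diff[OF yp(1) u(1)] has_ac_deriv_diff[OF yp(4) u(2)] _ _ _ _ _ x])
        show "AE x in lebesgue. x \<in> {a..b} \<longrightarrow>
          \<bar>(U x + l * (V x + l * V\<^sub>1 x + D x) + k\<^sup>2) * y x - U x * u x - U x * (y x - u x)\<bar>
            \<le> (l * C + l\<^sup>2 * C + k\<^sup>2) * Y + l * Y * \<bar>D x\<bar>"
          using bounds(2,3)
        proof eventually_elim
          case (elim x)
          show ?case
          proof
            assume x: "x \<in> {a..b}"
            have "\<bar>l * V x + l\<^sup>2 * V\<^sub>1 x + l * D x + k\<^sup>2\<bar> \<le> \<bar>l * V x\<bar> + \<bar>l\<^sup>2 * V\<^sub>1 x\<bar> + \<bar>l * D x\<bar> + \<bar>k\<^sup>2\<bar>"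
              by linarith
            also have "\<dots> \<le> l * C + l\<^sup>2 * C + l * \<bar>D x\<bar> + k\<^sup>2"
              using elim l by (auto simp: abs_mult intro!: add_mono mult_left_mono)
            finally have "\<bar>(l * V x + l\<^sup>2 * V\<^sub>1 x + l * D x + k\<^sup>2) * y x\<bar>
                \<le> (l * C + l\<^sup>2 * C + l * \<bar>D x\<bar> + k\<^sup>2) * Y"
              unfolding abs_mult using Y(2)[OF x] by (intro mult_mono) auto
            then show "\<bar>(U x + l * (V x + l * V\<^sub>1 x + D x) + k\<^sup>2) * y x - U x * u x - U x * (y x - u x)\<bar>
                \<le> (l * C + l\<^sup>2 * C + k\<^sup>2) * Y + l * Y * \<bar>D x\<bar>"
              by (simp add: algebra_simps power2_eq_square)
          qed
        qed
      qed (use yp u_bc Y l C0 in auto)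
      also have "(l * C + l\<^sup>2 * C + k\<^sup>2) * Y * d + l * Y * \<rho> \<le> Y * A0 * (l + k)"
      proof -
        have 1: "(l * C + l\<^sup>2 * C + k\<^sup>2) * d \<le> (l * C + l * C + k) * d"
          using sq C0 d0 by (intro mult_right_mono add_mono) auto
        have 2: "l * \<rho> \<le> l * 1" using \<rho> l l1 by (intro mult_left_mono) auto
        have 3: "0 \<le> 2 * C * d * k + k + d * l" using C0 d0 k l by simp
        have "(l * C + l\<^sup>2 * C + k\<^sup>2) * d + l * \<rho> \<le> A0 * (l + k)"
          unfolding A0_def using 1 2 3 by (simp add: algebra_simps)
        from mult_left_mono[OF this Y(1)] show ?thesis by (simp add: algebra_simps)
      qed
      finally show ?thesis using E1 by simp
    qed
    \<comment> \<open>by the choice of \<open>\<delta>\<close>, half of \<open>Y\<close> is absorbed on the left-hand side\<close>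
    have YY: "Y \<le> Y0"
    proof -
      have "Y \<le> \<bar>u x0\<bar> + \<bar>y x0 - u x0\<bar>" unfolding Y_def by linarith
      also have "\<dots> \<le> M + E * (k + Y * A0 * (l + k))" by (intro add_mono M zY x0)
      also have "\<dots> = M + E * k + Y * (E * A0 * (l + k))" by (simp add: algebra_simps)
      also have "\<dots> \<le> M + E * 1 + Y * (1 / 2)"
        using k1 E1 Y small by (intro add_mono mult_left_mono) auto
      finally show ?thesis by (simp add: Y0_def)
    qed
    have y_bd: "\<bar>y x\<bar> \<le> Y0" if "x \<in> {a..b}" for x using Y(2)[OF that] YY by linarith
    have z_bd: "\<bar>y x - u x\<bar> \<le> Z0 * (l + k)" if x: "x \<in> {a..b}" for x
    proof -
      have "\<bar>y x - u x\<bar> \<le> E * (k + Y * A0 * (l + k))" by (rule zY[OF x])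
      also have "\<dots> \<le> E * ((l + k) + Y0 * A0 * (l + k))"
        using E1 YY A00 l k by (intro mult_left_mono add_mono mult_right_mono) auto
      finally show ?thesis by (simp add: Z0_def algebra_simps)
    qed
    have w_bd: "\<bar>y x - u x - l * v x\<bar> \<le> W0 * (k + l\<^sup>2)" if x: "x \<in> {a..b}" for x
    proof -
      let ?\<alpha> = "l * C * (Z0 * (l + k)) + l\<^sup>2 * C * Y0 + k\<^sup>2 * Y0"
      have "\<bar>y x - u x - l * v x\<bar> \<le> E * (k + (?\<alpha> * d + l * Y0 * \<rho>))"
      proof (rule gron[OF has_ac_deriv_diff[OF has_ac_deriv_diff[OF yp(1) u(1)] has_ac_deriv_cmult[OF v(1)]]
            has_ac_deriv_diff[OF has_ac_deriv_diff[OF yp(4) u(2)] has_ac_deriv_cmult[OF v(2)]] _ _ _ _ _ x])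
        show "AE x in lebesgue. x \<in> {a..b} \<longrightarrow>
          \<bar>(U x + l * (V x + l * V\<^sub>1 x + D x) + k\<^sup>2) * y x - U x * u x - l * (U x * v x + V x * u x)
             - U x * (y x - u x - l * v x)\<bar> \<le> ?\<alpha> + l * Y0 * \<bar>D x\<bar>"
          using bounds(2,3)
        proof eventually_elim
          case (elim x)
          show ?case
          proof
            assume x: "x \<in> {a..b}"
            have 1: "\<bar>l * V x * (y x - u x)\<bar> \<le> l * C * (Z0 * (l + k))"
              unfolding abs_mult using elim l z_bd[OF x] C0 by (intro mult_mono) auto
            have 2: "\<bar>l\<^sup>2 * V\<^sub>1 x * y x\<bar> \<le> l\<^sup>2 * C * Y0"
              unfolding abs_mult using elim l y_bd[OF x] C0 by (intro mult_mono) auto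
            have 3: "\<bar>l * D x * y x\<bar> \<le> l * \<bar>D x\<bar> * Y0"
              unfolding abs_mult using l y_bd[OF x] by (intro mult_mono) auto
            have 4: "\<bar>k\<^sup>2 * y x\<bar> \<le> k\<^sup>2 * Y0"
              unfolding abs_mult using y_bd[OF x] by (intro mult_mono) auto
            have "(U x + l * (V x + l * V\<^sub>1 x + D x) + k\<^sup>2) * y x - U x * u x - l * (U x * v x + V x * u x)
                - U x * (y x - u x - l * v x)
              = l * V x * (y x - u x) + l\<^sup>2 * V\<^sub>1 x * y x + l * D x * y x + k\<^sup>2 * y x"
              by (simp add: algebra_simps power2_eq_square)
            then show "\<bar>(U x + l * (V x + l * V\<^sub>1 x + D x) + k\<^sup>2) * y x - U x * u x - l * (U x * v x + V x * u x)
                - U x * (y x - u x - l * v x)\<bar> \<le> ?\<alpha> + l * Y0 * \<bar>D x\<bar>"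
              using 1 2 3 4 by (simp add: mult.commute mult.left_commute)
          qed
        qed
      qed (use yp u_bc v_bc Y00 Z00 l k C0 in auto)
      also have "?\<alpha> * d + l * Y0 * \<rho> \<le> W1 * (k + l\<^sup>2)"
      proof -
        have 1: "C * Z0 * d * (l * (l + k)) \<le> C * Z0 * d * (k + l\<^sup>2)"
          using C0 Z00 d0 sq by (intro mult_left_mono) (auto simp: algebra_simps power2_eq_square)
        have 2: "Y0 * (l * \<rho>) \<le> Y0 * l\<^sup>2"
          using \<rho> l Y00 by (intro mult_left_mono) (auto simp: power2_eq_square)
        have 3: "Y0 * d * k\<^sup>2 \<le> Y0 * d * k" using sq Y00 d0 by (intro mult_left_mono) auto
        have 4: "0 \<le> C * Y0 * d * k" "0 \<le> Y0 * k" "0 \<le> Y0 * d * l\<^sup>2" using C0 Y00 d0 k by auto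
        show ?thesis unfolding W1_def using 1 2 3 4 by (simp add: algebra_simps)
      qed
      finally have "\<bar>y x - u x - l * v x\<bar> \<le> E * (k + W1 * (k + l\<^sup>2))" using E1 by simp
      also have "\<dots> \<le> E * ((k + l\<^sup>2) + W1 * (k + l\<^sup>2))" using E1 by (intro mult_left_mono) auto
      finally show ?thesis by (simp add: W0_def algebra_simps)
    qed
    let ?q = "\<lambda>x. (U x + l * (V x + l * V\<^sub>1 x + D x) + k\<^sup>2) * y x"
    let ?g = "\<lambda>x. (l * (V x + l * V\<^sub>1 x + D x) + k\<^sup>2) * y x * u x"
    \<comment> \<open>the Wronskian of \<open>y\<close> and \<open>u\<close>, in whose derivative \<open>U\<close> cancels\<close>
    have ac: "has_ac_deriv (\<lambda>x. p x * u x - y x * u' x)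
        (\<lambda>x. (?q x * u x + p x * u' x) - (p x * u' x + y x * (U x * u x)))"
      by (intro has_ac_deriv_diff has_ac_deriv_mult yp u)
    have g_eq: "(\<lambda>x. (?q x * u x + p x * u' x) - (p x * u' x + y x * (U x * u x))) = ?g"
      by (simp add: fun_eq_iff algebra_simps)
    have lg: "locally_integrable ?g"
      and "(p b * u b - y b * u' b) - (p a * u a - y a * u' a) = integral {a..b} ?g"
      using ac ab unfolding g_eq has_ac_deriv_iff by blast+
    then have g_int: "\<theta> * p b - k = integral {a..b} ?g"
      using yp(2,3) u_bc by (simp only: mult.commute[of \<theta>] mult_1_right mult_zero_right diff_zero)
    let ?h = "\<lambda>x. V x * v x * u x + V\<^sub>1 x * (u x)\<^sup>2" and ?o = "\<lambda>x. V x * (u x)\<^sup>2"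
    have lo: "locally_integrable ?o"
      by (rule locally_integrable_mult_continuous[OF locally_integrable_UV(2)]) (intro continuous_intros cu)
    have lh: "locally_integrable ?h"
    proof (rule locally_integrable_add)
      show "locally_integrable (\<lambda>x. V x * v x * u x)"
        by (intro locally_integrable_mult_continuous[OF locally_integrable_mult_continuous[OF locally_integrable_UV(2)]] cu cv)
      show "locally_integrable (\<lambda>x. V\<^sub>1 x * (u x)\<^sup>2)"
        by (rule locally_integrable_mult_continuous[OF locally_integrable_UV(3)]) (intro continuous_intros cu)
    qed
    let ?r = "\<lambda>x. ?g x - l\<^sup>2 * ?h x - l * ?o x"
    note lm = locally_integrable_bounded_linear[OF bounded_linear_mult_right]
    have lr: "locally_integrable ?r"
      by (rule locally_integrable_diff[OF locally_integrable_diff[OF lg lm[OF lh]] lm[OF lo]])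
    have "integral {a..b} ?r = integral {a..b} ?g - l\<^sup>2 * integral {a..b} ?h - l * integral {a..b} ?o"
      using integral_diff[OF locally_integrable_integrable_on[OF locally_integrable_diff[OF lg lm[OF lh]]]
          locally_integrable_integrable_on[OF lm[OF lo]], of a b "l\<^sup>2" l]
        integral_diff[OF locally_integrable_integrable_on[OF lg] locally_integrable_integrable_on[OF lm[OF lh]], of a b "l\<^sup>2"]
      by simp
    then have r_eq: "integral {a..b} ?r = \<theta> * p b - k - l\<^sup>2 * B"
      using g_int orthogonal by (simp add: B_def)
    let ?\<beta> = "l * C * (W0 * (k + l\<^sup>2)) * M + l\<^sup>2 * C * (Z0 * (l + k)) * M + k\<^sup>2 * Y0 * M"
    have "\<bar>integral {a..b} ?r\<bar> \<le> integral {a..b} (\<lambda>x. ?\<beta> + l * Y0 * M * \<bar>D x\<bar>)"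
    proof (rule abs_integral_le_AE_Icc[OF lr loc_aff])
      show "AE x in lebesgue. x \<in> {a..b} \<longrightarrow> \<bar>?r x\<bar> \<le> ?\<beta> + l * Y0 * M * \<bar>D x\<bar>"
        using bounds(2,3)
      proof eventually_elim
        case (elim x)
        show ?case
        proof
          assume x: "x \<in> {a..b}"
          have 1: "\<bar>l * V x * (y x - u x - l * v x) * u x\<bar> \<le> l * C * (W0 * (k + l\<^sup>2)) * M"
            unfolding abs_mult using elim l w_bd[OF x] C0 M(2)[OF x] W00 k by (intro mult_mono) auto
          have 2: "\<bar>l\<^sup>2 * V\<^sub>1 x * (y x - u x) * u x\<bar> \<le> l\<^sup>2 * C * (Z0 * (l + k)) * M"
            unfolding abs_mult using elim l z_bd[OF x] C0 M(2)[OF x] Z00 k by (intro mult_mono) auto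
          have 3: "\<bar>l * D x * y x * u x\<bar> \<le> l * \<bar>D x\<bar> * Y0 * M"
            unfolding abs_mult using l y_bd[OF x] M(2)[OF x] Y00 by (intro mult_mono) auto
          have 4: "\<bar>k\<^sup>2 * y x * u x\<bar> \<le> k\<^sup>2 * Y0 * M"
            unfolding abs_mult using y_bd[OF x] M(2)[OF x] Y00 by (intro mult_mono) auto
          have "?r x = l * V x * (y x - u x - l * v x) * u x + l\<^sup>2 * V\<^sub>1 x * (y x - u x) * u x
              + l * D x * y x * u x + k\<^sup>2 * y x * u x"
            by (simp add: algebra_simps power2_eq_square)
          then show "\<bar>?r x\<bar> \<le> ?\<beta> + l * Y0 * M * \<bar>D x\<bar>"
            using 1 2 3 4 by (simp add: mult.commute mult.left_commute)
        qed
      qed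
    qed
    also have "\<dots> = ?\<beta> * d + l * Y0 * M * \<rho>" by (rule int_aff)
    also have "\<dots> \<le> A1 * (k * (l + k) + l ^ 3 + l * \<rho>)"
    proof -
      let ?X = "k * (l + k) + l ^ 3 + l * \<rho>"
      have X: "l * (k + l\<^sup>2) \<le> ?X" "l\<^sup>2 * (l + k) \<le> ?X" "k\<^sup>2 \<le> ?X" "l * \<rho> \<le> ?X"
      proof -
        have nn: "0 \<le> l * k" "0 \<le> l ^ 3" "0 \<le> l * \<rho>" "0 \<le> k * k" using l k \<rho> by auto
        have "l * (l * k) \<le> 1 * (l * k)" using l1 nn by (intro mult_right_mono) auto
        then show "l * (k + l\<^sup>2) \<le> ?X" "l\<^sup>2 * (l + k) \<le> ?X" "k\<^sup>2 \<le> ?X" "l * \<rho> \<le> ?X"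
          using nn unfolding power2_eq_square power3_eq_cube distrib_left mult.assoc mult.commute[of k l] mult.left_commute[of k l]
          by linarith+
      qed
      have "?\<beta> * d + l * Y0 * M * \<rho> = (C * W0 * M * d) * (l * (k + l\<^sup>2)) + (C * Z0 * M * d) * (l\<^sup>2 * (l + k))
          + (Y0 * M) * (l * \<rho>) + (Y0 * M * d) * k\<^sup>2"
        by (simp add: algebra_simps)
      also have "\<dots> \<le> (C * W0 * M * d) * ?X + (C * Z0 * M * d) * ?X + (Y0 * M) * ?X + (Y0 * M * d) * ?X"
        using C0 W00 Z00 Y00 M(1) d0 by (intro add_mono mult_left_mono X) auto
      finally show ?thesis unfolding A1_def by (simp add: distrib_right)
    qed
    finally have R: "\<bar>\<theta> * p b - k - l\<^sup>2 * B\<bar> \<le> A1 * (k * (l + k) + l ^ 3 + l * \<rho>)"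
      by (simp only: r_eq)
    have "\<bar>k * \<theta> * (y b - u b)\<bar> \<le> k * \<bar>\<theta>\<bar> * (Z0 * (l + k))"
      unfolding abs_mult using k z_bd[of b] ab by (intro mult_mono) auto
    also have "\<dots> \<le> (\<bar>\<theta>\<bar> * Z0 + 1) * (k * (l + k) + l ^ 3 + l * \<rho>)"
    proof -
      have "(\<bar>\<theta>\<bar> * Z0) * (k * (l + k)) \<le> (\<bar>\<theta>\<bar> * Z0 + 1) * (k * (l + k) + l ^ 3 + l * \<rho>)"
        using Z00 k l \<rho> by (intro mult_mono) auto
      then show ?thesis by (simp add: mult.commute mult.left_commute)
    qed
    finally have S: "\<bar>k * \<theta> * (y b - u b)\<bar> \<le> (\<bar>\<theta>\<bar> * Z0 + 1) * (k * (l + k) + l ^ 3 + l * \<rho>)" .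
    have "\<theta> * (p b + k * y b) - (k * (1 + \<theta>\<^sup>2) + l\<^sup>2 * B)
        = (\<theta> * p b - k - l\<^sup>2 * B) + k * \<theta> * (y b - u b)"
      by (simp add: u_bc algebra_simps power2_eq_square)
    then have "\<bar>\<theta> * (p b + k * y b) - (k * (1 + \<theta>\<^sup>2) + l\<^sup>2 * B)\<bar>
        \<le> \<bar>\<theta> * p b - k - l\<^sup>2 * B\<bar> + \<bar>k * \<theta> * (y b - u b)\<bar>" by linarith
    also have "\<dots> \<le> A * (k * (l + k) + l ^ 3 + l * \<rho>)"
      using R S unfolding A_def by (simp add: distrib_right)
    finally show ?thesis by (simp only: \<rho>_def)
  qed
  show ?thesis
    using A_pos \<delta> main by blast
qed

end

section \<open>Supports, norms and boundary values\<close>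

text \<open>
  The complement of the support is covered by countably many of the balls that define it.
\<close>

lemma AE_zero_outside_ess_support: "AE x in lebesgue. x \<notin> ess_support f \<longrightarrow> f x = 0"
proof -
  define \<F> where "\<F> = {ball x r | x r. r > 0 \<and> (AE y in lebesgue. y \<in> ball x r \<longrightarrow> f y = 0)}"
  obtain \<G> where \<G>: "\<G> \<subseteq> \<F>" "countable \<G>" "\<Union>\<G> = \<Union>\<F>"
    by (rule Lindelof[of \<F>]) (auto simp: \<F>_def)
  have "AE y in lebesgue. \<forall>S\<in>\<G>. y \<in> S \<longrightarrow> f y = 0"
    using \<G>(1) by (subst AE_ball_countable[OF \<G>(2)]) (auto simp: \<F>_def)
  then show ?thesis
  proof eventually_elim
    case (elim y)
    show ?case
    proof
      assume "y \<notin> ess_support f"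
      then obtain r where r: "r > 0" "AE z in lebesgue. z \<in> ball y r \<longrightarrow> f z = 0"
        by (auto simp: ess_support_def)
      then have "ball y r \<in> \<F>" unfolding \<F>_def by blast
      then have "y \<in> \<Union>\<G>" unfolding \<G>(3) using r(1) centre_in_ball by blast
      then show "f y = 0" using elim by blast
    qed
  qed
qed

lemma integral_Icc_eq_LINT:
  fixes f :: "real \<Rightarrow> real"
  assumes m: "f \<in> borel_measurable lebesgue" and l: "locally_integrable f"
    and z: "AE x in lebesgue. x \<notin> {a..b} \<longrightarrow> f x = 0"
  shows "integrable lebesgue f" and "(LINT x|lebesgue. f x) = integral {a..b} f"
proof -
  have I: "set_integrable lebesgue {a..b} f" using l by (simp add: locally_integrable_def)
  have m': "(\<lambda>x. indicator {a..b} x *\<^sub>R f x) \<in> borel_measurable lebesgue"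
    by (intro borel_measurable_scaleR borel_measurable_indicator m) simp
  have eq: "AE x in lebesgue. indicator {a..b} x *\<^sub>R f x = f x"
    using z by eventually_elim (auto simp: indicator_def)
  show "integrable lebesgue f"
    using I integrable_cong_AE[OF m' m eq] by (simp add: set_integrable_def)
  have "(LINT x|lebesgue. f x) = (LINT x:{a..b}|lebesgue. f x)"
    unfolding set_lebesgue_integral_def using integral_cong_AE[OF m' m eq] by simp
  then show "(LINT x|lebesgue. f x) = integral {a..b} f"
    using set_lebesgue_integral_eq_integral(2)[OF I] by simp
qed

text \<open>
  The elementary inequality $|D| \le s + D^2/s$ replaces Cauchy--Schwarz: with \<open>s\<close> of the size of
  the norm it has the same order.
\<close>

lemma integral_abs_le_L2_norm:
  fixes D :: "real \<Rightarrow> real"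
  assumes m: "D \<in> borel_measurable lebesgue" and bd: "AE x in lebesgue. \<bar>D x\<bar> \<le> C"
    and z: "AE x in lebesgue. x \<notin> {a..b} \<longrightarrow> D x = 0"
    and s: "0 < s" "L2_norm D \<le> s" and ab: "a \<le> b"
  shows "integral {a..b} (\<lambda>x. \<bar>D x\<bar>) \<le> s * (b - a + 1)"
proof -
  have lD: "locally_integrable (\<lambda>x. \<bar>D x\<bar>)"
    by (rule locally_integrable_abs[OF locally_integrable_bounded[OF m bd]])
  have m2: "(\<lambda>x. (D x)\<^sup>2) \<in> borel_measurable lebesgue" using m by measurable
  have l2: "locally_integrable (\<lambda>x. (D x)\<^sup>2)"
  proof (rule locally_integrable_bounded[OF m2])
    show "AE x in lebesgue. \<bar>(D x)\<^sup>2\<bar> \<le> C\<^sup>2"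
      using bd
    proof eventually_elim
      case (elim x)
      then have "\<bar>D x\<bar> \<le> \<bar>C\<bar>" by linarith
      then show ?case by (simp add: abs_le_square_iff)
    qed
  qed
  have "(LINT x|lebesgue. (D x)\<^sup>2) = integral {a..b} (\<lambda>x. (D x)\<^sup>2)"
    by (rule integral_Icc_eq_LINT(2)[OF m2 l2]) (use z in \<open>eventually_elim, simp\<close>)
  moreover have "(LINT x|lebesgue. (D x)\<^sup>2) \<le> s\<^sup>2"
  proof -
    have "0 \<le> (LINT x|lebesgue. (D x)\<^sup>2)" by (rule Bochner_Integration.integral_nonneg) simp
    moreover have "(sqrt (LINT x|lebesgue. (D x)\<^sup>2))\<^sup>2 \<le> s\<^sup>2"
      by (rule power_mono) (use s calculation in \<open>simp_all add: L2_norm_def\<close>)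
    ultimately show ?thesis by (simp only: real_sqrt_pow2)
  qed
  ultimately have I2: "integral {a..b} (\<lambda>x. (D x)\<^sup>2) \<le> s\<^sup>2" by simp
  have i2: "(\<lambda>x. (1 / s) * (D x)\<^sup>2) integrable_on {a..b}"
    by (rule integrable_on_mult_right[OF locally_integrable_integrable_on[OF l2]])
  have "integral {a..b} (\<lambda>x. \<bar>D x\<bar>) \<le> integral {a..b} (\<lambda>x. s + (1 / s) * (D x)\<^sup>2)"
  proof (rule integral_le)
    fix x
    have "0 \<le> (s - \<bar>D x\<bar>)\<^sup>2" by simp
    then have "2 * (s * \<bar>D x\<bar>) \<le> s * s + (D x)\<^sup>2"
      by (simp add: power2_eq_square algebra_simps)
    moreover have "0 \<le> s * \<bar>D x\<bar>" using s by simp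
    ultimately have "s * \<bar>D x\<bar> \<le> s * s + (D x)\<^sup>2" by linarith
    then show "\<bar>D x\<bar> \<le> s + (1 / s) * (D x)\<^sup>2" using s by (simp add: field_simps)
  qed (intro locally_integrable_integrable_on[OF lD] integrable_add integrable_const_ivl i2)+
  also have "\<dots> = s * (b - a) + (1 / s) * integral {a..b} (\<lambda>x. (D x)\<^sup>2)"
    using integral_add[OF integrable_const_ivl[of s a b] i2] ab by simp
  also have "(1 / s) * integral {a..b} (\<lambda>x. (D x)\<^sup>2) \<le> (1 / s) * s\<^sup>2"
    using s I2 by (intro mult_left_mono) auto
  finally show ?thesis using s by (simp add: power2_eq_square algebra_simps)
qed

text \<open>
  Where \<open>U\<close> vanishes \<open>u\<close> is affine, and an affine function with a finite limit is constant.
\<close>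

lemma half_line_boundary_values:
  fixes u u' :: "real \<Rightarrow> real"
  assumes u: "has_ac_deriv u u'" "has_ac_deriv u' (\<lambda>x. U x * u x)"
  shows "AE x in lebesgue. b \<le> x \<longrightarrow> U x = 0 \<Longrightarrow> (u \<longlongrightarrow> \<theta>) at_top \<Longrightarrow> u b = \<theta> \<and> u' b = 0"
    and "AE x in lebesgue. x \<le> a \<longrightarrow> U x = 0 \<Longrightarrow> (u \<longlongrightarrow> \<theta>) at_bot \<Longrightarrow> u a = \<theta> \<and> u' a = 0"
proof -
  have affine: "u t = u s + u' s * (t - s) \<and> u' t = u' s"
    if "s \<le> t" "AE x in lebesgue. x \<in> {s..t} \<longrightarrow> U x = 0" for s t
  proof -
    have const: "u' r = u' s" if "r \<in> {s..t}" for r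
      by (rule has_ac_deriv_zero_imp_eq[OF u(2)])
        (use \<open>AE x in lebesgue. x \<in> {s..t} \<longrightarrow> U x = 0\<close> that in \<open>auto elim!: eventually_mono\<close>)
    have "u t - u s = integral {s..t} u'" using u(1) that(1) by (auto simp: has_ac_deriv_iff)
    also have "\<dots> = integral {s..t} (\<lambda>x. u' s)"
      by (rule integral_cong) (rule const)
    finally show ?thesis using const[of t] that(1) by (simp add: algebra_simps)
  qed
  {
    assume U: "AE x in lebesgue. b \<le> x \<longrightarrow> U x = 0" and lim: "(u \<longlongrightarrow> \<theta>) at_top"
    have aff: "u x = u b + u' b * (x - b)" if "b \<le> x" for x
      by (rule affine[OF that, THEN conjunct1]) (use U in \<open>eventually_elim, simp\<close>)
    have "filterlim (\<lambda>x. x - b) at_top at_top"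
      using filterlim_tendsto_add_at_top[OF tendsto_const[of "- b"] filterlim_ident] by simp
    then have "((\<lambda>x. (u x - u b) / (x - b)) \<longlongrightarrow> 0) at_top"
      using tendsto_divide_0[OF tendsto_diff[OF lim tendsto_const] filterlim_at_top_imp_at_infinity]
      by blast
    moreover have "\<forall>\<^sub>F x in at_top. (u x - u b) / (x - b) = u' b"

      using eventually_gt_at_top[of b]
    proof eventually_elim
      case (elim x)
      then show ?case using aff[of x] by simp
    qed
    ultimately have "u' b = 0"
      using tendsto_unique[OF trivial_limit_at_top_linorder] tendsto_eventually by metis
    have "\<forall>\<^sub>F x in at_top. u x = u b"

      using eventually_ge_at_top[of b]
    proof eventually_elim
      case (elim x)
      then show ?case using aff[of x] \<open>u' b = 0\<close> by simp
    qed
    then have "u b = \<theta>"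
      using lim tendsto_unique[OF trivial_limit_at_top_linorder] tendsto_eventually by metis
    with \<open>u' b = 0\<close> show "u b = \<theta> \<and> u' b = 0" by simp
  }
  {
    assume U: "AE x in lebesgue. x \<le> a \<longrightarrow> U x = 0" and lim: "(u \<longlongrightarrow> \<theta>) at_bot"
    have aff: "u x = u a - u' a * (a - x)" if "x \<le> a" for x
    proof -
      have "u a = u x + u' x * (a - x) \<and> u' a = u' x"
        by (rule affine[OF that]) (use U in \<open>eventually_elim, simp\<close>)
      then show ?thesis by simp
    qed
    have "filterlim (\<lambda>x. a - x) at_top at_bot"
      using filterlim_tendsto_add_at_top[OF tendsto_const[of a] filterlim_uminus_at_top_at_bot] by simp
    then have "((\<lambda>x. (u a - u x) / (a - x)) \<longlongrightarrow> 0) at_bot"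
      using tendsto_divide_0[OF tendsto_diff[OF tendsto_const lim] filterlim_at_top_imp_at_infinity]
      by blast
    moreover have "\<forall>\<^sub>F x in at_bot. (u a - u x) / (a - x) = u' a"

      using eventually_gt_at_bot[of a]
    proof eventually_elim
      case (elim x)
      then show ?case using aff[of x] by simp
    qed
    ultimately have "u' a = 0"
      using tendsto_unique[OF trivial_limit_at_bot_linorder] tendsto_eventually by metis
    have "\<forall>\<^sub>F x in at_bot. u x = u a"

      using eventually_le_at_bot[of a]
    proof eventually_elim
      case (elim x)
      then show ?case using aff[of x] \<open>u' a = 0\<close> by simp
    qed
    then have "u a = \<theta>"
      using lim tendsto_unique[OF trivial_limit_at_bot_linorder] tendsto_eventually by metis
    with \<open>u' a = 0\<close> show "u a = \<theta> \<and> u' a = 0" by simp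
  }
qed

section \<open>The threshold eigenvalue\<close>

context zero_energy_resonance
begin

text \<open>
  A weaker but more convenient form of the estimate: the remainder is $o(k + l^2)$, which suffices both
  for the sign change and for the asymptotics of the root.
\<close>

lemma jost_function_expansion:
  fixes D :: "real \<Rightarrow> real \<Rightarrow> real"
  assumes D: "\<forall>\<^sub>F l in at_right 0. locally_integrable (D l)"
    and small: "\<And>\<eta>. \<eta> > 0 \<Longrightarrow> \<forall>\<^sub>F l in at_right 0. integral {a..b} (\<lambda>x. \<bar>D l x\<bar>) \<le> \<eta> * l"
    and \<eta>: "\<eta> > 0"
  shows "\<exists>\<delta>>0. \<forall>\<^sub>F l in at_right 0. \<forall>k y p. 0 < k \<longrightarrow> k \<le> \<delta> \<longrightarrow>
    jost_solution (\<lambda>x. U x + l * (V x + l * V\<^sub>1 x + D l x)) a k y p \<longrightarrow>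
    \<bar>\<theta> * (p b + k * y b) - (k * (1 + \<theta>\<^sup>2) + l\<^sup>2 * B)\<bar> \<le> \<eta> * (k + l\<^sup>2)"
proof -
  obtain A \<delta> where A: "A > 0" and \<delta>: "\<delta> > 0"
    and est: "\<And>l k D y p. 0 < l \<Longrightarrow> l \<le> \<delta> \<Longrightarrow> 0 < k \<Longrightarrow> k \<le> \<delta> \<Longrightarrow> locally_integrable D \<Longrightarrow>
     integral {a..b} (\<lambda>x. \<bar>D x\<bar>) \<le> l \<Longrightarrow>
     jost_solution (\<lambda>x. U x + l * (V x + l * V\<^sub>1 x + D x)) a k y p \<Longrightarrow>
     \<bar>\<theta> * (p b + k * y b) - (k * (1 + \<theta>\<^sup>2) + l\<^sup>2 * B)\<bar>
       \<le> A * (k * (l + k) + l ^ 3 + l * integral {a..b} (\<lambda>x. \<bar>D x\<bar>))"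
    using jost_function_estimate by blast
  define \<epsilon> where "\<epsilon> = \<eta> / (2 * A)"
  have \<epsilon>: "\<epsilon> > 0" "A * (2 * \<epsilon>) = \<eta>" using A \<eta> by (auto simp: \<epsilon>_def)
  have "\<forall>\<^sub>F l in at_right 0. 0 < l \<and> l < min \<delta> \<epsilon>"
    using \<delta> \<epsilon> by (intro eventually_conj eventually_at_right_less eventually_at_right_field[THEN iffD2])
      (auto intro!: exI[of _ "min \<delta> \<epsilon>"])
  with D small[OF zero_less_one] small[OF \<epsilon>(1)]
  have "\<forall>\<^sub>F l in at_right 0. \<forall>k y p. 0 < k \<longrightarrow> k \<le> min \<delta> \<epsilon> \<longrightarrow>
    jost_solution (\<lambda>x. U x + l * (V x + l * V\<^sub>1 x + D l x)) a k y p \<longrightarrow>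
    \<bar>\<theta> * (p b + k * y b) - (k * (1 + \<theta>\<^sup>2) + l\<^sup>2 * B)\<bar> \<le> \<eta> * (k + l\<^sup>2)"
  proof eventually_elim
    case (elim l)
    show ?case
    proof (intro allI impI)
      fix k y p
      assume k: "0 < k" "k \<le> min \<delta> \<epsilon>"
        and y: "jost_solution (\<lambda>x. U x + l * (V x + l * V\<^sub>1 x + D l x)) a k y p"
      let ?\<rho> = "integral {a..b} (\<lambda>x. \<bar>D l x\<bar>)"
      have "\<bar>\<theta> * (p b + k * y b) - (k * (1 + \<theta>\<^sup>2) + l\<^sup>2 * B)\<bar> \<le> A * (k * (l + k) + l ^ 3 + l * ?\<rho>)"
        by (rule est) (use k y elim in auto)
      also have "\<dots> \<le> A * (k * (2 * \<epsilon>) + (\<epsilon> * l\<^sup>2 + \<epsilon> * l\<^sup>2))"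
      proof -
        have "k * (l + k) \<le> k * (2 * \<epsilon>)" using k elim by (intro mult_left_mono) auto
        moreover have "l * l\<^sup>2 \<le> \<epsilon> * l\<^sup>2" using elim by (intro mult_right_mono) auto
        moreover have "l * ?\<rho> \<le> l * (\<epsilon> * l)" using elim by (intro mult_left_mono) auto
        ultimately show ?thesis
          using A by (intro mult_left_mono) (auto simp: power2_eq_square power3_eq_cube algebra_simps)
      qed
      also have "\<dots> = (A * (2 * \<epsilon>)) * (k + l\<^sup>2)" by (simp add: algebra_simps)
      finally show "\<bar>\<theta> * (p b + k * y b) - (k * (1 + \<theta>\<^sup>2) + l\<^sup>2 * B)\<bar> \<le> \<eta> * (k + l\<^sup>2)"
        by (simp only: \<epsilon>(2))
    qed
  qed
  then show ?thesis using \<delta> \<epsilon> by (intro exI[of _ "min \<delta> \<epsilon>"]) auto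
qed

end

text \<open>
  First $\<eta> \le 1/2$ gives the crude bound $k \le (2c+1) l^2$; inserted into the estimate it yields
  $|k - c l^2| \le \<eta> (2c+2) l^2$, and then $k^2 - c^2 l^4 = (k - c l^2)(k + c l^2)$.
\<close>

lemma energy_asymptotics_from_wave_number:
  fixes k l K c B \<eta> :: real
  assumes "0 < k" "1 \<le> K" "c = - B / K" "0 < c" "\<eta> \<le> 1 / 2"
    and est: "\<bar>k * K + l\<^sup>2 * B\<bar> \<le> \<eta> * (k + l\<^sup>2)"
  shows "\<bar>- k\<^sup>2 + c\<^sup>2 * l ^ 4\<bar> \<le> \<eta> * ((2 * c + 2) * (3 * c + 1)) * l ^ 4"
proof -
  have "0 \<le> \<eta> * (k + l\<^sup>2)" using est abs_ge_zero order_trans by blast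
  moreover have "0 < k + l\<^sup>2" using assms(1) by (simp add: add_pos_nonneg)
  ultimately have \<eta>: "0 \<le> \<eta>" by (simp add: zero_le_mult_iff)
  have B: "B = - c * K" using assms(2,3) by simp
  have "\<bar>k - c * l\<^sup>2\<bar> * 1 \<le> \<bar>k - c * l\<^sup>2\<bar> * K" using assms(2) by (intro mult_left_mono) auto
  also have "\<dots> = \<bar>(k - c * l\<^sup>2) * K\<bar>" using assms(2) by (simp add: abs_mult)
  also have "(k - c * l\<^sup>2) * K = k * K + l\<^sup>2 * B" by (simp add: B algebra_simps)
  finally have 1: "\<bar>k - c * l\<^sup>2\<bar> \<le> \<eta> * (k + l\<^sup>2)" using est by simp
  have "\<eta> * (k + l\<^sup>2) \<le> (1 / 2) * (k + l\<^sup>2)" using assms by (intro mult_right_mono) auto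
  with 1 have k: "k \<le> (2 * c + 1) * l\<^sup>2" by (simp add: algebra_simps abs_le_iff)
  have 2: "\<bar>k - c * l\<^sup>2\<bar> \<le> \<eta> * ((2 * c + 2) * l\<^sup>2)"
  proof -
    have "k + l\<^sup>2 \<le> (2 * c + 2) * l\<^sup>2" using k by (simp add: algebra_simps)
    with 1 \<eta> show ?thesis by (meson mult_left_mono order_trans)
  qed
  have "- k\<^sup>2 + c\<^sup>2 * l ^ 4 = - ((k - c * l\<^sup>2) * (k + c * l\<^sup>2))"
    by (simp add: algebra_simps power2_eq_square power4_eq_xxxx)
  moreover have nn: "0 \<le> k + c * l\<^sup>2" using assms(1,4) by simp
  ultimately have "\<bar>- k\<^sup>2 + c\<^sup>2 * l ^ 4\<bar> = \<bar>k - c * l\<^sup>2\<bar> * (k + c * l\<^sup>2)"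
    by (simp only: abs_minus_cancel abs_mult abs_of_nonneg)
  also have "\<dots> \<le> (\<eta> * ((2 * c + 2) * l\<^sup>2)) * ((3 * c + 1) * l\<^sup>2)"
  proof (rule mult_mono[OF 2 _ _ nn])
    show "k + c * l\<^sup>2 \<le> (3 * c + 1) * l\<^sup>2" using k by (simp add: algebra_simps)
    show "0 \<le> \<eta> * ((2 * c + 2) * l\<^sup>2)" using \<eta> assms(4) by simp
  qed
  also have "\<dots> = \<eta> * ((2 * c + 2) * (3 * c + 1)) * l ^ 4"
    by (simp add: algebra_simps power2_eq_square power4_eq_xxxx)
  finally show ?thesis .
qed

theorem theorem2:
  fixes U V V\<^sub>1 :: "real \<Rightarrow> real"
    and V\<^sub>l :: "real \<Rightarrow> real \<Rightarrow> real"
    and u v :: "real \<Rightarrow> real"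
    and \<theta> :: real
  assumes U: "in_Linf U" "compact (ess_support U)"
    and V: "in_Linf V" "compact (ess_support V)"
    and V\<^sub>1: "in_Linf V\<^sub>1" "compact (ess_support V\<^sub>1)"
    and V\<^sub>l: "\<And>l. l > 0 \<Longrightarrow> in_Linf (V\<^sub>l l)" "\<And>l. l > 0 \<Longrightarrow> compact (ess_support (V\<^sub>l l))"
    and V\<^sub>l_supports: "\<exists>K. compact K \<and> (\<forall>\<^sub>F l in at_right 0. ess_support (V\<^sub>l l) \<subseteq> K)"
    and V\<^sub>l_expansion:
      "(\<lambda>l. L2_norm (\<lambda>x. V\<^sub>l l x - V x - l * V\<^sub>1 x)) \<in> o[at_right 0](\<lambda>l. l)"
    and u: "normalized_half_bound_state U u"
    and \<theta>: "(u \<longlongrightarrow> \<theta>) at_top"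
    and orthogonality: "(LINT x|lebesgue. V x * (u x)\<^sup>2) = 0"
    and v: "schrodinger_solution U (\<lambda>x. - V x * u x) v"
      "\<And>x. (\<And>y. y \<in> ess_support U \<union> ess_support V \<Longrightarrow> x < y) \<Longrightarrow> v x = 0"
    and negative: "(LINT x|lebesgue. (V x * v x + V\<^sub>1 x * u x) * u x) < 0"
  shows "zero_coupling_constant_threshold (\<lambda>l x. U x + l * V\<^sub>l l x) \<and>
    (\<forall>e. threshold_eigenvalue (\<lambda>l x. U x + l * V\<^sub>l l x) e \<longrightarrow>
      (\<lambda>l. e l - (- (l ^ 4 / (\<theta>\<^sup>2 + 1)\<^sup>2 *
          ((LINT x|lebesgue. V x * v x * u x) + (LINT x|lebesgue. V\<^sub>1 x * (u x)\<^sup>2))\<^sup>2)))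
        \<in> o[at_right 0](\<lambda>l. l ^ 4))"
proof -
  obtain K where K: "compact K" "\<forall>\<^sub>F l in at_right 0. ess_support (V\<^sub>l l) \<subseteq> K"
    using V\<^sub>l_supports by blast
  define S where "S = ess_support U \<union> ess_support V \<union> ess_support V\<^sub>1 \<union> K"
  have "bounded S"
    unfolding S_def using U(2) V(2) V\<^sub>1(2) K(1) by (auto intro: compact_imp_bounded)
  then obtain r where r: "\<And>x. x \<in> S \<Longrightarrow> \<bar>x\<bar> \<le> r"
    unfolding bounded_iff real_norm_def by blast
  \<comment> \<open>one unit of room to the left of the supports lets \<open>v\<close> vanish in a neighbourhood of \<open>a\<close>\<close>
  define a b where "a = - \<bar>r\<bar> - 1" and "b = \<bar>r\<bar> + 1"
  have ab: "a \<le> b" by (simp add: a_def b_def)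
  have inS: "a < x \<and> x < b" if "x \<in> S" for x
    using r[OF that] by (auto simp: a_def b_def abs_le_iff)
  have out: "AE x in lebesgue. x \<notin> {a<..<b} \<longrightarrow> f x = 0" if "ess_support f \<subseteq> S" for f
    using AE_zero_outside_ess_support[of f] by eventually_elim (use that inS in auto)
  have outU: "AE x in lebesgue. x \<notin> {a<..<b} \<longrightarrow> U x = 0"
    and outV: "AE x in lebesgue. x \<notin> {a<..<b} \<longrightarrow> V x = 0"
    and outV1: "AE x in lebesgue. x \<notin> {a<..<b} \<longrightarrow> V\<^sub>1 x = 0"
    by (rule out, force simp: S_def)+
  have outVl: "\<forall>\<^sub>F l in at_right 0. AE x in lebesgue. x \<notin> {a<..<b} \<longrightarrow> V\<^sub>l l x = 0"
    using K(2) by eventually_elim (rule out, force simp: S_def)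

  obtain CU CV CV1 where CC: "AE x in lebesgue. \<bar>U x\<bar> \<le> CU" "AE x in lebesgue. \<bar>V x\<bar> \<le> CV"
    "AE x in lebesgue. \<bar>V\<^sub>1 x\<bar> \<le> CV1"
    using U(1) V(1) V\<^sub>1(1) unfolding in_Linf_def by blast
  define C where "C = max CU (max CV CV1)"
  have meas: "U \<in> borel_measurable lebesgue" "V \<in> borel_measurable lebesgue"
      "V\<^sub>1 \<in> borel_measurable lebesgue"
    using U(1) V(1) V\<^sub>1(1) unfolding in_Linf_def by blast+
  have bounds: "AE x in lebesgue. \<bar>U x\<bar> \<le> C" "AE x in lebesgue. \<bar>V x\<bar> \<le> C"
      "AE x in lebesgue. \<bar>V\<^sub>1 x\<bar> \<le> C"
    by (rule eventually_mono[OF CC(1)], simp add: C_def, rule eventually_mono[OF CC(2)], simp add: C_def,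
        rule eventually_mono[OF CC(3)], simp add: C_def)

  obtain u' u'' where u': "has_ac_deriv u u'" and u'': "has_ac_deriv u' u''"
    "AE x in lebesgue. - u'' x + U x * u x = 0"
    using u unfolding normalized_half_bound_state_def half_bound_state_def schrodinger_solution_def
    by blast
  have u'_ac: "has_ac_deriv u' (\<lambda>x. U x * u x)"
    by (rule has_ac_deriv_cong_AE[OF u''(1)]) (use u''(2) in \<open>eventually_elim, simp\<close>)
  obtain v' v'' where v': "has_ac_deriv v v'" and v'': "has_ac_deriv v' v''"
    "AE x in lebesgue. - v'' x + U x * v x = - V x * u x"
    using v(1) unfolding schrodinger_solution_def by blast
  have v'_ac: "has_ac_deriv v' (\<lambda>x. U x * v x + V x * u x)"
    by (rule has_ac_deriv_cong_AE[OF v''(1)]) (use v''(2) in \<open>eventually_elim, simp\<close>)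
  have "AE x in lebesgue. b \<le> x \<longrightarrow> U x = 0" "AE x in lebesgue. x \<le> a \<longrightarrow> U x = 0"
    using outU by (auto elim!: eventually_mono)
  then have u_bc: "u b = \<theta> \<and> u' b = 0" "u a = 1 \<and> u' a = 0"
    using half_line_boundary_values[OF u' u'_ac] \<theta> u unfolding normalized_half_bound_state_def
    by blast+
  have v0: "v x = 0" if "x < a + 1" for x
  proof (rule v(2))
    fix y assume "y \<in> ess_support U \<union> ess_support V"
    then have "\<bar>y\<bar> \<le> r" by (intro r) (auto simp: S_def)
    then show "x < y" using that by (auto simp: a_def abs_le_iff)
  qed
  have v_bc: "v a = 0" "v' a = 0"
  proof -
    show "v a = 0" by (rule v0) simp
    have "(v has_real_derivative 0) (at a)"
      by (rule has_field_derivative_transform_within_open[of "\<lambda>x. 0" _ _ "{..<a + 1}"]) (auto simp: v0)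
    then show "v' a = 0"
      using has_ac_deriv_has_real_derivative[OF v' has_ac_deriv_continuous[OF v'_ac]] DERIV_unique by blast
  qed
  have cu: "continuous_on UNIV u" and cv: "continuous_on UNIV v"
    using has_ac_deriv_continuous[OF u'] has_ac_deriv_continuous[OF v'] by auto
  have lV: "locally_integrable V" and lV1: "locally_integrable V\<^sub>1"
    by (rule locally_integrable_bounded; fact meas bounds)+
  have LINT_V: "integrable lebesgue (\<lambda>x. f x * g x)"
      "(LINT x|lebesgue. f x * g x) = integral {a..b} (\<lambda>x. f x * g x)"
    if f: "f \<in> borel_measurable lebesgue" "locally_integrable f"
      "AE x in lebesgue. x \<notin> {a<..<b} \<longrightarrow> f x = 0" and g: "continuous_on UNIV g"
    for f g :: "real \<Rightarrow> real"
  proof -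
    have "g \<in> borel_measurable lebesgue"
      using g by (auto intro!: measurable_completion borel_measurable_continuous_onI)
    then have 1: "(\<lambda>x. f x * g x) \<in> borel_measurable lebesgue"
      using f(1) by measurable
    have 2: "AE x in lebesgue. x \<notin> {a..b} \<longrightarrow> f x * g x = 0"
      using f(3) by eventually_elim auto
    show "integrable lebesgue (\<lambda>x. f x * g x)"
      "(LINT x|lebesgue. f x * g x) = integral {a..b} (\<lambda>x. f x * g x)"
      by (rule integral_Icc_eq_LINT[OF 1 locally_integrable_mult_continuous[OF f(2) g] 2])+
  qed
  note LV = LINT_V[OF meas(2) lV outV] and LV1 = LINT_V[OF meas(3) lV1 outV1]
  have cvu: "continuous_on UNIV (\<lambda>x. v x * u x)" and cu2: "continuous_on UNIV (\<lambda>x. (u x)\<^sup>2)"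
    by (intro continuous_intros cu cv)+

  interpret zero_energy_resonance U V V\<^sub>1 u u' v v' a b C \<theta>
    by standard (use ab meas bounds u' u'_ac u_bc v' v'_ac v_bc orthogonality LV(2)[OF cu2] in simp_all)

  have B1: "(LINT x|lebesgue. V x * v x * u x) + (LINT x|lebesgue. V\<^sub>1 x * (u x)\<^sup>2) = B"
    using LV(2)[OF cvu] LV1(2)[OF cu2]
      integral_add[OF locally_integrable_integrable_on[OF locally_integrable_mult_continuous[OF lV cvu]]
        locally_integrable_integrable_on[OF locally_integrable_mult_continuous[OF lV1 cu2]], of a b]
    by (simp add: B_def mult.assoc)
  have B2: "B < 0"
  proof -
    have "(LINT x|lebesgue. (V x * v x + V\<^sub>1 x * u x) * u x)
        = (LINT x|lebesgue. V x * (v x * u x) + V\<^sub>1 x * (u x)\<^sup>2)"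
      by (simp add: algebra_simps power2_eq_square)
    also have "\<dots> = (LINT x|lebesgue. V x * (v x * u x)) + (LINT x|lebesgue. V\<^sub>1 x * (u x)\<^sup>2)"
      by (rule Bochner_Integration.integral_add[OF LV(1)[OF cvu] LV1(1)[OF cu2]])
    finally show ?thesis using negative B1 by (simp add: mult.assoc)
  qed
  define \<kappa> where "\<kappa> = 1 + \<theta>\<^sup>2"
  define c where "c = - B / \<kappa>"
  have \<kappa>: "1 \<le> \<kappa>" by (simp add: \<kappa>_def)
  have c: "0 < c" unfolding c_def using B2 \<kappa> by (simp add: divide_neg_pos)
  have B_eq: "B = - c * \<kappa>" using \<kappa> by (simp add: c_def)

  define D where "D l x = V\<^sub>l l x - V x - l * V\<^sub>1 x" for l x
  define W where "W l x = U x + l * V\<^sub>l l x" for l x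
  have W_eq: "(\<lambda>x. U x + l * (V x + l * V\<^sub>1 x + D l x)) = W l" for l
    by (simp add: fun_eq_iff W_def D_def)
  have pos: "\<forall>\<^sub>F l in at_right 0. 0 < (l :: real)" by (rule eventually_at_right_less)
  have Vl: "V\<^sub>l l \<in> borel_measurable lebesgue" "\<exists>C. AE x in lebesgue. \<bar>V\<^sub>l l x\<bar> \<le> C" if "0 < l" for l
    using V\<^sub>l(1)[OF that] by (auto simp: in_Linf_def)
  have D: "D l \<in> borel_measurable lebesgue" "\<exists>C. AE x in lebesgue. \<bar>D l x\<bar> \<le> C" if l: "0 < l" for l
  proof -
    show "D l \<in> borel_measurable lebesgue"
      unfolding D_def[abs_def] using Vl(1)[OF l] meas by measurable
    obtain C' where C': "AE x in lebesgue. \<bar>V\<^sub>l l x\<bar> \<le> C'" using Vl(2)[OF l] by blast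
    have "AE x in lebesgue. \<bar>D l x\<bar> \<le> C' + C + l * C"
      using C' bounds(2,3)
    proof eventually_elim
      case (elim x)
      have "\<bar>l * V\<^sub>1 x\<bar> \<le> l * C" using elim l by (simp add: abs_mult)
      with elim show ?case unfolding D_def by linarith
    qed
    then show "\<exists>C. AE x in lebesgue. \<bar>D l x\<bar> \<le> C" by blast
  qed
  have Wl: "W l \<in> borel_measurable lebesgue" "\<exists>C. AE x in lebesgue. \<bar>W l x\<bar> \<le> C" if l: "0 < l" for l
  proof -
    show "W l \<in> borel_measurable lebesgue"
      unfolding W_def[abs_def] using Vl(1)[OF l] meas by measurable
    obtain C' where C': "AE x in lebesgue. \<bar>V\<^sub>l l x\<bar> \<le> C'" using Vl(2)[OF l] by blast
    have "AE x in lebesgue. \<bar>W l x\<bar> \<le> C + l * C'"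
      using C' bounds(1)
    proof eventually_elim
      case (elim x)
      have "\<bar>l * V\<^sub>l l x\<bar> \<le> l * C'" using elim l by (simp add: abs_mult)
      with elim show ?case unfolding W_def by linarith
    qed
    then show "\<exists>C. AE x in lebesgue. \<bar>W l x\<bar> \<le> C" by blast
  qed
  have Wout: "\<forall>\<^sub>F l in at_right 0. AE x in lebesgue. x \<notin> {a<..<b} \<longrightarrow> W l x = 0"
    using outVl
  proof eventually_elim
    case (elim l)
    show ?case using elim outU by eventually_elim (simp add: W_def)
  qed
  have D_loc: "\<forall>\<^sub>F l in at_right 0. locally_integrable (D l)"
    using pos
  proof eventually_elim
    case (elim l)
    then show ?case using D(1)[OF elim] D(2)[OF elim] locally_integrable_bounded by blast
  qed
  have D_small: "\<forall>\<^sub>F l in at_right 0. integral {a..b} (\<lambda>x. \<bar>D l x\<bar>) \<le> \<eta> * l" if \<eta>: "\<eta> > 0" for \<eta>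
  proof -
    define \<epsilon> where "\<epsilon> = \<eta> / (b - a + 1)"
    have \<epsilon>: "\<epsilon> > 0" using \<eta> ab by (simp add: \<epsilon>_def)
    have "\<forall>\<^sub>F l in at_right 0. norm (L2_norm (\<lambda>x. V\<^sub>l l x - V x - l * V\<^sub>1 x)) \<le> \<epsilon> * norm l"
      using landau_o.smallD[OF V\<^sub>l_expansion \<epsilon>] .
    with pos outVl show ?thesis
    proof eventually_elim
      case (elim l)
      have z: "AE x in lebesgue. x \<notin> {a..b} \<longrightarrow> D l x = 0"
        using elim(2) outV outV1 by eventually_elim (auto simp: D_def)
      obtain C' where C': "AE x in lebesgue. \<bar>D l x\<bar> \<le> C'" using D(2) elim(1) by blast
      have "integral {a..b} (\<lambda>x. \<bar>D l x\<bar>) \<le> (\<epsilon> * l) * (b - a + 1)"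
      proof (rule integral_abs_le_L2_norm[OF D(1)[OF elim(1)] C' z _ _ ab])
        show "0 < \<epsilon> * l" using \<epsilon> elim(1) by simp
        show "L2_norm (D l) \<le> \<epsilon> * l"
          using elim(1,3) by (simp add: D_def[abs_def])
      qed
      also have "\<dots> = \<eta> * l" using ab by (simp add: \<epsilon>_def)
      finally show ?case .
    qed
  qed
  have expansion: "\<exists>\<delta>>0. \<forall>\<^sub>F l in at_right 0. \<forall>k y p. 0 < k \<longrightarrow> k \<le> \<delta> \<longrightarrow>
      jost_solution (W l) a k y p \<longrightarrow>
      \<bar>\<theta> * (p b + k * y b) - (k * \<kappa> + l\<^sup>2 * B)\<bar> \<le> \<eta> * (k + l\<^sup>2)" if "\<eta> > 0" for \<eta>
    using jost_function_expansion[of D, OF D_loc D_small that] unfolding W_eq \<kappa>_def .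

  have "\<forall>\<^sub>F l in at_right 0. \<exists>k. 0 < k \<and> k \<le> 2 * c * l\<^sup>2 \<and> schrodinger_eigenvalue (W l) (of_real (- k\<^sup>2))"
  proof -
    \<comment> \<open>\<open>\<eta>\<close> is small enough for the leading part $\<kappa> (k - c l^2)$ to dominate at $c l^2/2$ and $2 c l^2$\<close>
    define \<eta> where "\<eta> = c / (2 * c + 2)"
    have \<eta>: "0 < \<eta>" using c by (simp add: \<eta>_def)
    obtain \<delta> where \<delta>: "\<delta> > 0" and ex: "\<forall>\<^sub>F l in at_right 0. \<forall>k y p. 0 < k \<longrightarrow> k \<le> \<delta> \<longrightarrow>
        jost_solution (W l) a k y p \<longrightarrow>
        \<bar>\<theta> * (p b + k * y b) - (k * \<kappa> + l\<^sup>2 * B)\<bar> \<le> \<eta> * (k + l\<^sup>2)"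
      using expansion[OF \<eta>] by blast
    have "((\<lambda>l::real. 2 * c * l\<^sup>2) \<longlongrightarrow> 2 * c * 0\<^sup>2) (at_right 0)" by (intro tendsto_intros)
    then have "\<forall>\<^sub>F l in at_right 0. 2 * c * l\<^sup>2 < \<delta>"
      by (rule order_tendstoD(2)) (simp add: \<delta>)
    with ex pos Wout show ?thesis
    proof eventually_elim
      case (elim l)
      have l2: "0 < l\<^sup>2" using elim(2) by simp
      have cl: "0 < c * l\<^sup>2" using c l2 by simp
      obtain C' where C': "AE x in lebesgue. \<bar>W l x\<bar> \<le> C'" using Wl(2)[OF elim(2)] by blast
      have W0: "AE x in lebesgue. x < a \<longrightarrow> W l x = 0" "AE x in lebesgue. x \<notin> {a..b} \<longrightarrow> W l x = 0"
        using elim(3) by (auto elim!: eventually_mono)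
      have c\<kappa>: "c * l\<^sup>2 \<le> c * l\<^sup>2 * \<kappa>" using mult_left_mono[OF \<kappa>, of "c * l\<^sup>2"] cl by simp
      have "\<exists>k y p. c / 2 * l\<^sup>2 \<le> k \<and> k \<le> 2 * c * l\<^sup>2 \<and> jost_solution (W l) a k y p \<and> p b + k * y b = 0"
      proof (rule jost_function_root[OF Wl(1)[OF elim(2)] C' W0(1) ab, where s = \<theta>])
        show "0 < c / 2 * l\<^sup>2" "c / 2 * l\<^sup>2 \<le> 2 * c * l\<^sup>2" using cl by auto
      next
        fix y p assume J: "jost_solution (W l) a (c / 2 * l\<^sup>2) y p"
        have "c / 2 * l\<^sup>2 \<le> \<delta>" "0 < c / 2 * l\<^sup>2" using elim(4) cl by auto
        then have "\<bar>\<theta> * (p b + c / 2 * l\<^sup>2 * y b) - (c / 2 * l\<^sup>2 * \<kappa> + l\<^sup>2 * B)\<bar>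
            \<le> \<eta> * (c / 2 * l\<^sup>2 + l\<^sup>2)"
          by (intro elim(1)[rule_format, OF _ _ J])
        moreover have "c / 2 * l\<^sup>2 * \<kappa> + l\<^sup>2 * B = - (c * l\<^sup>2 * \<kappa> / 2)"
          by (simp add: B_eq algebra_simps)
        moreover have "\<eta> * (c / 2 * l\<^sup>2 + l\<^sup>2) = c * l\<^sup>2 * ((c / 2 + 1) / (2 * c + 2))"
          by (simp add: \<eta>_def algebra_simps add_divide_distrib)
        moreover have "c * l\<^sup>2 * ((c / 2 + 1) / (2 * c + 2)) < c * l\<^sup>2 * (1 / 2)"
          using cl c by (intro mult_strict_left_mono) (auto simp: field_simps)
        ultimately show "\<theta> * (p b + c / 2 * l\<^sup>2 * y b) < 0"
          using c\<kappa> by linarith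
      next
        fix y p assume J: "jost_solution (W l) a (2 * c * l\<^sup>2) y p"
        have "2 * c * l\<^sup>2 \<le> \<delta>" "0 < 2 * c * l\<^sup>2" using elim(4) cl by auto
        then have "\<bar>\<theta> * (p b + 2 * c * l\<^sup>2 * y b) - (2 * c * l\<^sup>2 * \<kappa> + l\<^sup>2 * B)\<bar>
            \<le> \<eta> * (2 * c * l\<^sup>2 + l\<^sup>2)"
          by (intro elim(1)[rule_format, OF _ _ J])
        moreover have "2 * c * l\<^sup>2 * \<kappa> + l\<^sup>2 * B = c * l\<^sup>2 * \<kappa>"
          by (simp add: B_eq algebra_simps)
        moreover have "\<eta> * (2 * c * l\<^sup>2 + l\<^sup>2) = c * l\<^sup>2 * ((2 * c + 1) / (2 * c + 2))"
          by (simp add: \<eta>_def algebra_simps add_divide_distrib)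
        moreover have "c * l\<^sup>2 * ((2 * c + 1) / (2 * c + 2)) \<le> c * l\<^sup>2 * 1"
          using cl c by (intro mult_left_mono) (auto simp: field_simps)
        ultimately show "0 \<le> \<theta> * (p b + 2 * c * l\<^sup>2 * y b)"
          using c\<kappa> by linarith
      qed
      then obtain k y p where k: "c / 2 * l\<^sup>2 \<le> k" "k \<le> 2 * c * l\<^sup>2"
        and J: "jost_solution (W l) a k y p" "p b + k * y b = 0" by blast
      have k0: "0 < k" using k cl by simp
      have "schrodinger_eigenvalue (W l) (of_real (- k\<^sup>2))"
        by (rule jost_root_imp_eigenvalue[OF J Wl(1)[OF elim(2)] W0(2) C' k0])
      with k k0 show ?case by blast
    qed
  qed
  then have ev: "\<forall>\<^sub>F l in at_right 0. \<exists>e. - (2 * c * l\<^sup>2)\<^sup>2 \<le> e \<and> e < 0 \<and> schrodinger_eigenvalue (W l) (of_real e)"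
  proof eventually_elim
    case (elim l)
    then obtain k where k: "0 < k" "k \<le> 2 * c * l\<^sup>2" "schrodinger_eigenvalue (W l) (of_real (- k\<^sup>2))" by blast
    have "k\<^sup>2 \<le> (2 * c * l\<^sup>2)\<^sup>2" using k by (intro power_mono) auto
    then show ?case using k by (intro exI[of _ "- k\<^sup>2"] conjI) auto
  qed
  define e where "e l = (SOME e. - (2 * c * l\<^sup>2)\<^sup>2 \<le> e \<and> e < 0 \<and> schrodinger_eigenvalue (W l) (of_real e))" for l
  have e: "\<forall>\<^sub>F l in at_right 0. - (2 * c * l\<^sup>2)\<^sup>2 \<le> e l \<and> e l < 0 \<and> schrodinger_eigenvalue (W l) (of_real (e l))"
    using ev unfolding e_def by eventually_elim (rule someI_ex)
  have "(e \<longlongrightarrow> 0) (at_right 0)"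
  proof (rule tendsto_sandwich)
    show "\<forall>\<^sub>F l in at_right 0. - (2 * c * l\<^sup>2)\<^sup>2 \<le> e l" "\<forall>\<^sub>F l in at_right 0. e l \<le> 0"
      using e by (auto elim!: eventually_mono)
    have "((\<lambda>l::real. - (2 * c * l\<^sup>2)\<^sup>2) \<longlongrightarrow> - (2 * c * 0\<^sup>2)\<^sup>2) (at_right 0)" by (intro tendsto_intros)
    then show "((\<lambda>l::real. - (2 * c * l\<^sup>2)\<^sup>2) \<longlongrightarrow> 0) (at_right 0)" by simp
  qed simp
  moreover have "\<forall>\<^sub>F l in at_right 0. e l < 0 \<and> schrodinger_eigenvalue (W l) (of_real (e l))"
    using e by eventually_elim blast
  ultimately have "threshold_eigenvalue W e"
    unfolding threshold_eigenvalue_def by blast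
  then have exists: "zero_coupling_constant_threshold W"
    unfolding zero_coupling_constant_threshold_def by blast

  have asymptotics: "(\<lambda>l. e l - (- (l ^ 4 / (\<theta>\<^sup>2 + 1)\<^sup>2 *
          ((LINT x|lebesgue. V x * v x * u x) + (LINT x|lebesgue. V\<^sub>1 x * (u x)\<^sup>2))\<^sup>2)))
        \<in> o[at_right 0](\<lambda>l. l ^ 4)"
    if e: "threshold_eigenvalue W e" for e
  proof (rule landau_o.smallI)
    fix \<epsilon> :: real assume \<epsilon>: "\<epsilon> > 0"
    \<comment> \<open>the constant of \<open>energy_asymptotics_from_wave_number\<close>\<close>
    define G where "G = (2 * c + 2) * (3 * c + 1)"
    have G: "0 < G" using c by (simp add: G_def)
    define \<eta> where "\<eta> = min (1 / 2) (\<epsilon> / G)"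
    have \<eta>: "0 < \<eta>" "\<eta> \<le> 1 / 2" "\<eta> \<le> \<epsilon> / G"
      unfolding \<eta>_def using \<epsilon> G by (simp, intro min.cobounded1, intro min.cobounded2)
    have \<eta>G: "\<eta> * G \<le> \<epsilon>" using \<eta>(3) G by (simp add: field_simps)
    obtain \<delta> where \<delta>: "\<delta> > 0" and ex: "\<forall>\<^sub>F l in at_right 0. \<forall>k y p. 0 < k \<longrightarrow> k \<le> \<delta> \<longrightarrow>
        jost_solution (W l) a k y p \<longrightarrow>
        \<bar>\<theta> * (p b + k * y b) - (k * \<kappa> + l\<^sup>2 * B)\<bar> \<le> \<eta> * (k + l\<^sup>2)"
      using expansion[OF \<eta>(1)] by blast
    have e_ev: "\<forall>\<^sub>F l in at_right 0. e l < 0 \<and> schrodinger_eigenvalue (W l) (of_real (e l))"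
      and e_lim: "(e \<longlongrightarrow> 0) (at_right 0)"
      using e unfolding threshold_eigenvalue_def by auto
    have "\<forall>\<^sub>F l in at_right 0. - \<delta>\<^sup>2 < e l"
      by (rule order_tendstoD(1)[OF e_lim]) (use \<delta> in simp)
    with ex pos Wout e_ev
    show "\<forall>\<^sub>F l in at_right 0. norm (e l - (- (l ^ 4 / (\<theta>\<^sup>2 + 1)\<^sup>2 *
          ((LINT x|lebesgue. V x * v x * u x) + (LINT x|lebesgue. V\<^sub>1 x * (u x)\<^sup>2))\<^sup>2)))
        \<le> \<epsilon> * norm (l ^ 4)"
    proof eventually_elim
      case (elim l)
      define k where "k = sqrt (- e l)"
      have k: "0 < k" "e l = - k\<^sup>2" using elim(4) by (auto simp: k_def)
      have k\<delta>: "k \<le> \<delta>"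
        unfolding k_def using elim(5) \<delta> by (intro real_le_lsqrt) auto
      obtain C' where C': "AE x in lebesgue. \<bar>W l x\<bar> \<le> C'" using Wl(2)[OF elim(2)] by blast
      have W0: "AE x in lebesgue. x \<notin> {a..b} \<longrightarrow> W l x = 0"
        using elim(3) by (auto elim!: eventually_mono)
      have "schrodinger_eigenvalue (W l) (of_real (- k\<^sup>2))" using elim(4) k(2) by simp
      from eigenvalue_imp_jost_root[OF this k(1) W0 C' ab]
      obtain y p where J: "jost_solution (W l) a k y p" "p b + k * y b = 0"
        by blast
      have "\<bar>\<theta> * (p b + k * y b) - (k * \<kappa> + l\<^sup>2 * B)\<bar> \<le> \<eta> * (k + l\<^sup>2)"
        by (rule elim(1)[rule_format, OF k(1) k\<delta> J(1)])
      then have "\<bar>k * \<kappa> + l\<^sup>2 * B\<bar> \<le> \<eta> * (k + l\<^sup>2)"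
        unfolding J(2) by linarith
      from energy_asymptotics_from_wave_number[OF k(1) \<kappa> c_def c \<eta>(2) this]
      have "\<bar>e l + c\<^sup>2 * l ^ 4\<bar> \<le> \<eta> * G * l ^ 4" by (simp add: k(2) G_def)
      also have "\<dots> \<le> \<epsilon> * l ^ 4" using \<eta>G by (intro mult_right_mono) auto
      finally have "\<bar>e l + c\<^sup>2 * l ^ 4\<bar> \<le> \<epsilon> * \<bar>l ^ 4\<bar>" by simp
      moreover have "c\<^sup>2 * l ^ 4 = l ^ 4 / (\<theta>\<^sup>2 + 1)\<^sup>2 * B\<^sup>2"
        by (simp add: c_def \<kappa>_def power_divide add.commute)
      ultimately show ?case
        unfolding B1 real_norm_def by (simp only: diff_minus_eq_add)
    qed
  qed
  have "(\<lambda>l x. U x + l * V\<^sub>l l x) = W" by (simp add: fun_eq_iff W_def)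
  with exists asymptotics show ?thesis by simp
qed

end
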